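(* Let $k=\mathbf{C}$ and let $n$ be a positive integer. Define $$A_0=k\langle\langle a,b\rangle\rangle/(ab+ba,\;a^2+b^{2n+1}),\qquad A_i=k\langle\langle a,b\rangle\rangle/(ab+ba,\;a^2+b^{2n+1}+b^{2i})\quad(1\le i\le 2n).$$ Then $A_0,A_{n+1},\dots,A_{2n}$ have the same dimension $6n+3$ as $k$-linear spaces, and are non-isomorphic to each other as associative $k$-algebras.
   Context: $k\langle\langle a,b\rangle\rangle$ is the non-commutative formal power series ring in two variables, and $(\cdots)$ denotes the two-sided ideal generated by the listed elements. *)

theory Defs
  imports Complex_Main "HOL-Computational_Algebra.Formal_Power_Series" "HOL-Algebra.QuotRing" "Jordan_Normal_Form.VS_Connect"
begin

section \<open>Non-commutative formal power series\<close>

text \<open>An element of \<open>k\<langle>\<langle>X\<rangle>\<rangle>\<close> is an arbitrary family of coefficients indexed by the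
  words over the alphabet \<^typ>\<open>'x\<close>; the product is the Cauchy product over all
  factorisations \<open>w = u @ v\<close>, here enumerated by the length of \<open>u\<close>.\<close>

typedef ('x, 'k) ncfps = "UNIV :: ('x list \<Rightarrow> 'k) set"
  morphisms nc_coeff Abs_ncfps ..

setup_lifting type_definition_ncfps

lemma ncfps_eqI: "(\<And>w. nc_coeff f w = nc_coeff g w) \<Longrightarrow> f = g"
  by (metis nc_coeff_inject ext)

instantiation ncfps :: (type, ring_1) ring_1
begin

lift_definition zero_ncfps :: "('a, 'b) ncfps" is "\<lambda>w. 0" .
lift_definition one_ncfps :: "('a, 'b) ncfps" is "\<lambda>w. if w = [] then 1 else 0" .
lift_definition plus_ncfps :: "('a, 'b) ncfps \<Rightarrow> ('a, 'b) ncfps \<Rightarrow> ('a, 'b) ncfps"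
  is "\<lambda>f g w. f w + g w" .
lift_definition minus_ncfps :: "('a, 'b) ncfps \<Rightarrow> ('a, 'b) ncfps \<Rightarrow> ('a, 'b) ncfps"
  is "\<lambda>f g w. f w - g w" .
lift_definition uminus_ncfps :: "('a, 'b) ncfps \<Rightarrow> ('a, 'b) ncfps"
  is "\<lambda>f w. - f w" .
lift_definition times_ncfps :: "('a, 'b) ncfps \<Rightarrow> ('a, 'b) ncfps \<Rightarrow> ('a, 'b) ncfps"
  is "\<lambda>f g w. \<Sum>i = 0..length w. f (take i w) * g (drop i w)" .

instance
proof
  fix f g h :: "('a, 'b) ncfps"
  show "f * g * h = f * (g * h)"
  proof (rule ncfps_eqI)
    fix w :: "'a list"
    let ?n = "length w"
    let ?F = "\<lambda>i j (_::nat). nc_coeff f (take i w) * nc_coeff g (take j (drop i w))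
                 * nc_coeff h (drop (i + j) w)"
    have "nc_coeff (f * g * h) w = (\<Sum>j = 0..?n. \<Sum>i = 0..j. ?F i (j - i) (?n - j))"
      unfolding times_ncfps.rep_eq sum_distrib_right
      by (intro sum.cong refl) (auto simp: min_def drop_take)
    also have "\<dots> = (\<Sum>j = 0..?n. \<Sum>i = 0..?n - j. ?F j i (?n - j - i))"
      by (rule fps_mult_assoc_lemma)
    also have "\<dots> = nc_coeff (f * (g * h)) w"
      unfolding times_ncfps.rep_eq sum_distrib_left
      by (intro sum.cong refl) (auto simp: mult.assoc add.commute)
    finally show "nc_coeff (f * g * h) w = nc_coeff (f * (g * h)) w" .
  qed
  show "1 * f = f"
  proof (rule ncfps_eqI)
    fix w :: "'a list"
    have "nc_coeff (1 * f) w = (\<Sum>i = 0..length w. if i = 0 then nc_coeff f w else 0)"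
      unfolding times_ncfps.rep_eq one_ncfps.rep_eq by (intro sum.cong refl) auto
    then show "nc_coeff (1 * f) w = nc_coeff f w" by simp
  qed
  show "f * 1 = f"
  proof (rule ncfps_eqI)
    fix w :: "'a list"
    have "nc_coeff (f * 1) w = (\<Sum>i = 0..length w. if i = length w then nc_coeff f w else 0)"
      unfolding times_ncfps.rep_eq one_ncfps.rep_eq by (intro sum.cong refl) auto
    then show "nc_coeff (f * 1) w = nc_coeff f w" by simp
  qed
  show "(f + g) * h = f * h + g * h" "f * (g + h) = f * g + f * h"
    by (transfer; simp add: algebra_simps sum.distrib fun_eq_iff)+
  show "(0 :: ('a, 'b) ncfps) \<noteq> 1"
    by transfer (auto simp: fun_eq_iff)
qed (transfer; simp add: algebra_simps fun_eq_iff)+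

end

lift_definition nc_smult :: "'k::ring_1 \<Rightarrow> ('x, 'k) ncfps \<Rightarrow> ('x, 'k) ncfps"
  is "\<lambda>c f w. c * f w" .

lift_definition nc_var :: "'x \<Rightarrow> ('x, 'k::ring_1) ncfps"
  is "\<lambda>x w. if w = [x] then 1 else 0" .

section \<open>Quotient algebras\<close>

text \<open>A \<open>k\<close>-algebra is represented by a \<^type>\<open>module\<close> record, which carries the ring operations
  together with a scalar multiplication. The ideal \<^const>\<open>genideal\<close> is two-sided, and no
  topological closure is taken. The scalar multiplication of the quotient is
  \<open>c \<odot> (I + f) = I + c f\<close>, phrased on cosets in the same style as \<^const>\<open>rcoset_mult\<close>.\<close>

definition nc_quotient ::
    "('x, 'k::field) ncfps set \<Rightarrow> ('k, ('x, 'k) ncfps set) module" where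
  "nc_quotient S =
     (let I = genideal class_ring S; Q = class_ring Quot I
      in \<lparr>carrier = carrier Q, mult = mult Q, one = one Q, zero = zero Q, add = add Q,
          smult = (\<lambda>c X. \<Union>f\<in>X. I +>\<^bsub>class_ring\<^esub> nc_smult c f)\<rparr>)"

definition algebra_iso :: "('k, 'a) module \<Rightarrow> ('k, 'b) module \<Rightarrow> ('a \<Rightarrow> 'b) set" where
  "algebra_iso A B =
     {h \<in> ring_iso A B. \<forall>c. \<forall>x\<in>carrier A. h (c \<odot>\<^bsub>A\<^esub> x) = c \<odot>\<^bsub>B\<^esub> h x}"

definition algebra_isomorphic :: "('k, 'a) module \<Rightarrow> ('k, 'b) module \<Rightarrow> bool" where
  "algebra_isomorphic A B \<longleftrightarrow> algebra_iso A B \<noteq> {}"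

section \<open>The algebras \<open>A\<^sub>i\<close>\<close>

datatype letter = Letter_a | Letter_b

abbreviation ser_a :: "(letter, complex) ncfps" where "ser_a \<equiv> nc_var Letter_a"
abbreviation ser_b :: "(letter, complex) ncfps" where "ser_b \<equiv> nc_var Letter_b"

definition alg_A :: "nat \<Rightarrow> nat \<Rightarrow> (complex, (letter, complex) ncfps set) module" where
  "alg_A n i =
     (if i = 0
      then nc_quotient {ser_a * ser_b + ser_b * ser_a, ser_a ^ 2 + ser_b ^ (2 * n + 1)}
      else nc_quotient {ser_a * ser_b + ser_b * ser_a,
                        ser_a ^ 2 + ser_b ^ (2 * n + 1) + ser_b ^ (2 * i)})"

section \<open>The quotients are vector spaces\<close>

lemma nc_smult_simps:
  "nc_smult (c + d) f = nc_smult c f + nc_smult d f"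
  "nc_smult c (f + g) = nc_smult c f + nc_smult c g"
  "nc_smult (c * d) f = nc_smult c (nc_smult d f)"
  "nc_smult 1 f = f"
  by (transfer; simp add: algebra_simps fun_eq_iff)+

lemma nc_smult_mult_left: "nc_smult c (f * g) = nc_smult c f * g"
  by (rule ncfps_eqI) (simp add: nc_smult.rep_eq times_ncfps.rep_eq sum_distrib_left mult.assoc)

lemma nc_smult_mult_right:
  fixes c :: "'k::comm_ring_1"
  shows "nc_smult c (f * g) = f * nc_smult c g"
  by (rule ncfps_eqI)
     (simp add: nc_smult.rep_eq times_ncfps.rep_eq sum_distrib_left mult.left_commute)

lemma nc_smult_conv_mult: "nc_smult c f = nc_smult c 1 * f"
  by (metis mult_1 nc_smult_mult_left)

context
  fixes S :: "('x, 'k::field) ncfps set"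
begin

abbreviation (input) "nc_R \<equiv> (class_ring :: ('x, 'k) ncfps ring)"
abbreviation (input) "nc_I \<equiv> genideal nc_R S"

lemma nc_ideal: "ideal nc_I nc_R"
  by (rule ring.genideal_ideal[OF class_ring.ring_axioms]) simp

lemma nc_coset_eq: "nc_I +>\<^bsub>nc_R\<^esub> f = {x + f |x. x \<in> nc_I}"
  by (auto simp: a_r_coset_def r_coset_def)

lemma nc_carrier: "carrier (nc_quotient S) = range (\<lambda>f. nc_I +>\<^bsub>nc_R\<^esub> f)"
  by (auto simp: nc_quotient_def Let_def FactRing_def A_RCOSETS_defs a_r_coset_def r_coset_def)

lemma nc_coset_cong:
  assumes "x - y \<in> nc_I"
  shows "nc_I +>\<^bsub>nc_R\<^esub> x = nc_I +>\<^bsub>nc_R\<^esub> y"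
proof -
  interpret I: ideal nc_I nc_R by (rule nc_ideal)
  have add: "\<And>u v. u \<in> nc_I \<Longrightarrow> v \<in> nc_I \<Longrightarrow> u + v \<in> nc_I" using I.a_closed by simp
  have neg: "- u \<in> nc_I" if "u \<in> nc_I" for u
    using I.I_l_closed[OF that, of "- 1"] by simp
  have "u + x \<in> {u + y |u. u \<in> nc_I}" if "u \<in> nc_I" for u
    using add[OF that assms] by (auto intro!: exI[of _ "u + (x - y)"])
  moreover have "u + y \<in> {u + x |u. u \<in> nc_I}" if "u \<in> nc_I" for u
    using add[OF that neg[OF assms]] by (auto intro!: exI[of _ "u + (y - x)"])
  ultimately show ?thesis unfolding nc_coset_eq by blast
qed

lemma nc_quotient_smult:
  "c \<odot>\<^bsub>nc_quotient S\<^esub> (nc_I +>\<^bsub>nc_R\<^esub> f) = nc_I +>\<^bsub>nc_R\<^esub> nc_smult c f"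
proof -
  interpret I: ideal nc_I nc_R by (rule nc_ideal)
  have "nc_I +>\<^bsub>nc_R\<^esub> nc_smult c (x + f) = nc_I +>\<^bsub>nc_R\<^esub> nc_smult c f" if "x \<in> nc_I" for x
  proof (rule nc_coset_cong)
    have "nc_smult c (x + f) - nc_smult c f = nc_smult c 1 * x"
      by (subst (1 2) nc_smult_conv_mult) (simp add: algebra_simps)
    then show "nc_smult c (x + f) - nc_smult c f \<in> nc_I"
      using I.I_l_closed[OF that, of "nc_smult c 1"] by simp
  qed
  moreover have "0 \<in> nc_I" using I.zero_closed by simp
  ultimately show ?thesis
    unfolding nc_quotient_def Let_def by (auto simp: nc_coset_eq[of f] intro!: exI[of _ 0])
qed

lemma nc_quotient_add:
  "(nc_I +>\<^bsub>nc_R\<^esub> f) \<oplus>\<^bsub>nc_quotient S\<^esub> (nc_I +>\<^bsub>nc_R\<^esub> g) = nc_I +>\<^bsub>nc_R\<^esub> (f + g)"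
proof -
  interpret I: ideal nc_I nc_R by (rule nc_ideal)
  show ?thesis using I.a_rcos_sum[of f g] by (simp add: nc_quotient_def Let_def FactRing_def)
qed

lemma nc_quotient_mult:
  "(nc_I +>\<^bsub>nc_R\<^esub> f) \<otimes>\<^bsub>nc_quotient S\<^esub> (nc_I +>\<^bsub>nc_R\<^esub> g) = nc_I +>\<^bsub>nc_R\<^esub> (f * g)"
proof -
  interpret I: ideal nc_I nc_R by (rule nc_ideal)
  show ?thesis using I.rcoset_mult_add[of f g] by (simp add: nc_quotient_def Let_def FactRing_def)
qed

lemma nc_quotient_ring: "ring (nc_quotient S)"
proof -
  interpret Q: ring "nc_R Quot nc_I" by (rule ideal.quotient_is_ring[OF nc_ideal])
  note simps = nc_quotient_def Let_def
  show ?thesis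
  proof (rule ringI)
    show "abelian_group (nc_quotient S)"
      by (rule abelian_groupI)
         (auto simp: simps Q.add.m_ac intro: Q.l_neg Q.a_inv_closed)
    show "Group.monoid (nc_quotient S)"
      by (rule monoidI) (auto simp: simps Q.m_assoc)
  qed (auto simp: simps Q.l_distr Q.r_distr)
qed

lemma nc_quotient_vectorspace: "vectorspace class_ring (nc_quotient S)"
proof -
  interpret Q: ring "nc_quotient S" by (rule nc_quotient_ring)
  have "module class_ring (nc_quotient S)"
  proof (rule moduleI)
    show "cring (class_ring :: 'k ring)" by (rule class_cring.cring_axioms)
    show "abelian_group (nc_quotient S)" by (rule Q.abelian_group_axioms)
  qed (auto simp: nc_carrier nc_quotient_smult nc_quotient_add nc_smult_simps)
  then show ?thesis
    unfolding vectorspace_def using class_field.field_axioms by blast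
qed

lemma nc_quotient_smult_mult:
  assumes "x \<in> carrier (nc_quotient S)" "y \<in> carrier (nc_quotient S)"
  shows "c \<odot>\<^bsub>nc_quotient S\<^esub> (x \<otimes>\<^bsub>nc_quotient S\<^esub> y) = (c \<odot>\<^bsub>nc_quotient S\<^esub> x) \<otimes>\<^bsub>nc_quotient S\<^esub> y"
    and "c \<odot>\<^bsub>nc_quotient S\<^esub> (x \<otimes>\<^bsub>nc_quotient S\<^esub> y) = x \<otimes>\<^bsub>nc_quotient S\<^esub> (c \<odot>\<^bsub>nc_quotient S\<^esub> y)"
  using assms
  by (auto simp only: nc_carrier nc_quotient_smult nc_quotient_mult
        nc_smult_mult_left[symmetric] nc_smult_mult_right[symmetric])

end

end

theory Submission
  imports Defs
begin

text \<open>Put \<open>N = 2n + 1\<close> and \<open>f(b) = b\<^sup>N + b\<^sup>2\<^sup>i\<close>, or \<open>f(b) = b\<^sup>N\<close> if \<open>i = 0\<close>, so that the relations of the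
algebra are \<open>a b = - b a\<close> and \<open>a\<^sup>2 = - f(b)\<close>.

\<^emph>\<open>Dimension.\<close> Since \<open>a\<close> commutes with \<open>a\<^sup>2\<close>, it commutes with \<open>f(b)\<close>. It commutes with even powers of
\<open>b\<close> and anticommutes with odd ones, so \<open>2 b\<^sup>N a = 0\<close>; multiplying \<open>a\<^sup>2 = - f(b)\<close> by \<open>b\<^sup>N\<close> then gives
\<open>b\<^sup>N f(b) = 0\<close>, and \<open>b\<^sup>2\<^sup>N = 0\<close> because \<open>f\<close> is \<open>b\<^sup>N\<close> times a unit. Hence the \<open>3N = 6n + 3\<close> elements
\<open>b\<^sup>k\<close> (\<open>k < 2N\<close>) and \<open>b\<^sup>k a\<close> (\<open>k < N\<close>) span. For their independence, map the free series to the twisted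
power series ring in which \<open>a X = - X a\<close>; if \<open>\<Sum> C\<^sub>k a\<^sup>k\<close> is the image of \<open>F\<close>, then
reducing with \<open>a\<^sup>2 = - f\<close> and \<open>a\<^sup>3 = 0\<close> leaves the pair \<open>C\<^sub>0 - f C\<^sub>2\<close> modulo \<open>X\<^sup>2\<^sup>N\<close> and \<open>C\<^sub>1\<close> modulo
\<open>X\<^sup>N\<close>, called \<open>b_part\<close> and \<open>a_part\<close> below. The series with vanishing pair form an ideal that contains
the relations, and the spanning argument shows that its kernel is
exactly the ideal (\<open>I_eq_K\<close>). The ideal is the algebraic one, without topological closure, so
infinite sums have to be cut off first; this is possible because long words lie in the ideal.

\<^emph>\<open>Non-isomorphism.\<close> An isomorphism from the algebra with index \<open>l\<close> to the one with index \<open>i\<close> yields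
series \<open>F\<close>, \<open>G\<close>, the images of \<open>a\<close> and \<open>b\<close>, that satisfy the relations with index \<open>l\<close> in the algebra
with index \<open>i\<close>. Let \<open>G = r b + s a + \<dots>\<close>, and let \<open>q\<close> be the coefficient of \<open>a\<close> in \<open>F\<close>. The nilpotency
order of \<open>b\<close> forces \<open>r \<noteq> 0\<close>, and the lowest coefficients of the two relations force \<open>q\<^sup>2 = r\<^sup>N\<close> and
\<open>3 q\<^sup>2 s = 0\<close> (\<open>rigidity\<close>). With \<open>s = 0\<close>, the series \<open>G\<close> is odd in \<open>b\<close> to high order, so \<open>G\<^sup>N\<close> is odd and
\<open>G\<^sup>2\<^sup>l\<close> is even up to degree \<open>4n\<close>. The even part of \<open>F\<^sup>2 + G\<^sup>N + G\<^sup>2\<^sup>l = 0\<close> therefore equates \<open>G\<^sup>2\<^sup>l\<close>, of order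
\<open>2l\<close>, with \<open>b\<^sup>2\<^sup>i\<close> times a unit (where either side is \<open>0\<close> if its index is \<open>0\<close>), and \<open>l = i\<close>
follows (\<open>index_determined\<close>).\<close>

section \<open>Divisibility of power series by powers of X\<close>

(* The matrix library also uses the infix for vector entries. *)
no_notation vec_index (infixl "$" 100)
unbundle fps_syntax

lemma fps_X_power_dvd_iff:
  fixes p :: "'k::comm_ring_1 fps"
  shows "fps_X ^ d dvd p \<longleftrightarrow> (\<forall>k<d. p $ k = 0)"
proof
  assume "\<forall>k<d. p $ k = 0"
  then have "p = fps_X ^ d * fps_shift d p"
    by (simp add: fps_eq_iff fps_X_power_mult_nth)
  then show "fps_X ^ d dvd p" by (rule dvdI)
qed (auto simp: fps_X_power_mult_nth)

lemma X_power_dvd_mult: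
  fixes p q :: "'k::comm_ring_1 fps"
  assumes "fps_X ^ a dvd p" "fps_X ^ b dvd q" "k \<le> a + b"
  shows "fps_X ^ k dvd p * q"
  using mult_dvd_mono[OF assms(1,2)] le_imp_power_dvd[OF assms(3), of fps_X]
  by (metis dvd_trans power_add)

lemma lowest_coeff_mult:
  fixes p q :: "'k::comm_ring_1 fps"
  assumes "fps_X ^ a dvd p" "fps_X ^ b dvd q"
  shows "(p * q) $ (a + b) = p $ a * q $ b"
proof -
  obtain p' q' where pq: "p = fps_X ^ a * p'" "q = fps_X ^ b * q'"
    using assms by (auto elim!: dvdE)
  then have "p * q = fps_X ^ (a + b) * (p' * q')"
    by (simp add: power_add mult_ac)
  then show ?thesis by (simp add: pq fps_X_power_mult_nth)
qed

lemma X_power_dvd_cancel: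
  fixes p q :: "complex fps"
  assumes "fps_X ^ (a + b) dvd p * q" "fps_X ^ b dvd q" "q $ b \<noteq> 0"
  shows "fps_X ^ a dvd p"
proof -
  obtain q' where q: "q = fps_X ^ b * q'"
    using assms(2) by (auto elim!: dvdE)
  then have "q' $ 0 \<noteq> 0"
    using assms(3) by (simp add: fps_X_power_mult_nth)
  then have "q' dvd 1" by simp
  have "fps_X ^ b * fps_X ^ a dvd fps_X ^ b * (p * q')"
    using assms(1) by (simp add: q power_add mult_ac)
  then have "fps_X ^ a dvd p * q'"
    by (subst (asm) dvd_mult_cancel_left) simp
  then show ?thesis
    using dvd_mult_unit_iff[OF \<open>q' dvd 1\<close>] by blast
qed

lemma X_power_dvd_power_diff:
  fixes p q :: "complex fps"
  assumes "fps_X ^ d dvd p - q" "fps_X ^ 2 dvd p" "fps_X ^ 2 dvd q"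
  shows "fps_X ^ (d + 2 * k) dvd p ^ Suc k - q ^ Suc k"
proof (induction k)
  case (Suc k)
  have "fps_X ^ (2 * Suc k) dvd q ^ Suc k"
    using dvd_power_same[OF assms(3), of "Suc k"] by (simp only: power_mult)
  then have "fps_X ^ (d + 2 * Suc k) dvd (p - q) * q ^ Suc k"
    by (rule X_power_dvd_mult[OF assms(1)]) simp
  moreover have "fps_X ^ (d + 2 * Suc k) dvd p * (p ^ Suc k - q ^ Suc k)"
    by (rule X_power_dvd_mult[OF assms(2) Suc]) simp
  ultimately have "fps_X ^ (d + 2 * Suc k) dvd p * (p ^ Suc k - q ^ Suc k) + (p - q) * q ^ Suc k"
    by (rule dvd_add[rotated])
  then show ?case by (simp add: algebra_simps)
qed (use assms in simp)

lemma X_power_dvd_le: "fps_X ^ b dvd (p :: complex fps) \<Longrightarrow> a \<le> b \<Longrightarrow> fps_X ^ a dvd p"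
  using dvd_trans le_imp_power_dvd by blast

lemma X_power_dvd_nth: "fps_X ^ b dvd (p :: complex fps) \<Longrightarrow> k < b \<Longrightarrow> p $ k = 0"
  by (simp add: fps_X_power_dvd_iff)

section \<open>The substitution of -X for X\<close>

definition flip :: "complex fps \<Rightarrow> complex fps" where
  "flip p = p oo (- fps_X)"

lemma flip_nth [simp]: "flip p $ k = (-1) ^ k * p $ k"
  by (simp add: flip_def fps_compose_uminus')

lemma flip_add [simp]: "flip (p + q) = flip p + flip q"
  and flip_diff [simp]: "flip (p - q) = flip p - flip q"
  and flip_0 [simp]: "flip 0 = 0"
  and flip_1 [simp]: "flip 1 = 1"
  and flip_flip [simp]: "flip (flip p) = p"
  by (auto simp: fps_eq_iff algebra_simps simp flip: power_add mult.assoc)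

lemma flip_mult [simp]: "flip (p * q) = flip p * flip q"
  unfolding flip_def by (rule fps_compose_mult_distrib) simp

lemma flip_power [simp]: "flip (p ^ k) = flip p ^ k"
  by (induction k) auto

lemma flip_const [simp]: "flip (fps_const c) = fps_const c"
  by (auto simp: fps_eq_iff)

lemma flip_X [simp]: "flip fps_X = - fps_X"
  by (auto simp: fps_eq_iff fps_X_def)

lemma X_power_dvd_flip [simp]: "fps_X ^ d dvd flip p \<longleftrightarrow> fps_X ^ d dvd p"
  by (auto simp: fps_X_power_dvd_iff)

section \<open>Splitting off the first letter of a noncommutative series\<close>

lemma nc_smult_diff: "nc_smult c (F - G) = nc_smult c F - nc_smult c G"
  by transfer (simp add: fun_eq_iff algebra_simps)

lemma nc_smult_zero: "nc_smult 0 F = 0" and nc_smult_uminus: "nc_smult (- c) F = - nc_smult c F"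
  by (transfer; simp add: fun_eq_iff)+

lift_definition left_shift :: "'x list \<Rightarrow> ('x, 'k) ncfps \<Rightarrow> ('x, 'k) ncfps"
  is "\<lambda>u f w. f (u @ w)" .

lemma left_shift_linear [simp]:
  "left_shift u (F + G) = left_shift u F + left_shift u G"
  "left_shift u (F - G) = left_shift u F - left_shift u G"
  "left_shift u (nc_smult c F) = nc_smult c (left_shift u F)"
  by (transfer; simp)+

lemma left_shift_append: "left_shift (u @ v) F = left_shift v (left_shift u F)"
  by transfer simp

text \<open>A factorisation of \<open>x # w\<close> has either an empty first factor, which contributes the second summand, or
a first factor that begins with \<open>x\<close>.\<close>

lemma left_shift_mult:
  "left_shift [x] (F * G) = left_shift [x] F * G + nc_smult (nc_coeff F []) (left_shift [x] G)"
proof (rule ncfps_eqI)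
  fix w
  have "nc_coeff (left_shift [x] (F * G)) w
      = (\<Sum>i = 0..Suc (length w). nc_coeff F (take i (x # w)) * nc_coeff G (drop i (x # w)))"
    by (simp add: left_shift.rep_eq times_ncfps.rep_eq)
  also have "\<dots> = nc_coeff (left_shift [x] F * G + nc_smult (nc_coeff F []) (left_shift [x] G)) w"
    by (subst sum.atLeast0_atMost_Suc_shift)
       (simp add: left_shift.rep_eq times_ncfps.rep_eq plus_ncfps.rep_eq nc_smult.rep_eq)
  finally show "nc_coeff (left_shift [x] (F * G)) w
      = nc_coeff (left_shift [x] F * G + nc_smult (nc_coeff F []) (left_shift [x] G)) w" .
qed

lemma left_shift_var: "left_shift [x] (nc_var y) = (if x = y then 1 else 0)"
  by transfer (auto simp: fun_eq_iff)

lemma nc_coeff_mult_Nil [simp]: "nc_coeff (F * G) [] = nc_coeff F [] * nc_coeff G []"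
  by (simp add: times_ncfps.rep_eq)

lemma nc_var_mult_coeff:
  "nc_coeff (nc_var x * F) w = (case w of [] \<Rightarrow> 0 | y # v \<Rightarrow> if y = x then nc_coeff F v else 0)"
proof (cases w)
  case (Cons y v)
  have "nc_coeff (nc_var x * F) (y # v) = nc_coeff (left_shift [y] (nc_var x * F)) v"
    by (simp add: left_shift.rep_eq)
  then show ?thesis
    using Cons by (simp add: left_shift_mult left_shift_var nc_var.rep_eq plus_ncfps.rep_eq
        zero_ncfps.rep_eq nc_smult.rep_eq)
qed (simp add: nc_var.rep_eq)

lemma first_letter_expansion:
  fixes F :: "(letter, 'k::field) ncfps"
  shows "F = nc_smult (nc_coeff F []) 1 + nc_var Letter_a * left_shift [Letter_a] F
             + nc_var Letter_b * left_shift [Letter_b] F"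
proof (rule ncfps_eqI)
  fix w
  show "nc_coeff F w = nc_coeff (nc_smult (nc_coeff F []) 1 + nc_var Letter_a * left_shift [Letter_a] F
             + nc_var Letter_b * left_shift [Letter_b] F) w"
  proof (cases w)
    case (Cons y v)
    then show ?thesis
      by (cases y) (simp_all add: plus_ncfps.rep_eq nc_smult.rep_eq one_ncfps.rep_eq
          nc_var_mult_coeff left_shift.rep_eq)
  qed (simp add: plus_ncfps.rep_eq nc_smult.rep_eq one_ncfps.rep_eq nc_var_mult_coeff)
qed

section \<open>Coefficients in the twisted power series ring\<close>

text \<open>The twisted power series ring has a central field of constants and two generators \<open>X\<close>, \<open>a\<close> with
\<open>a X = - X a\<close>, so its elements are uniquely \<open>\<Sum> C\<^sub>k a\<^sup>k\<close> with power series \<open>C\<^sub>k\<close> in \<open>X\<close>, written on the left.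
Sending \<open>b\<close> to \<open>X\<close> maps a series \<open>F\<close> to such a sum, and \<open>a_coeff k F\<close> is its \<open>C\<^sub>k\<close>. The recursion cuts a word
with \<open>k + 1\<close> letters \<open>a\<close> after the first of them: the prefix is \<open>b\<^sup>m a\<close>, and moving this \<open>a\<close> to the right
past a power series in \<open>X\<close> flips the series.\<close>

primrec a_coeff :: "nat \<Rightarrow> (letter, complex) ncfps \<Rightarrow> complex fps" where
  "a_coeff 0 F = Abs_fps (\<lambda>m. nc_coeff F (replicate m Letter_b))"
| "a_coeff (Suc k) F = Abs_fps (\<lambda>l. \<Sum>m\<le>l.
     flip (a_coeff k (left_shift (replicate m Letter_b @ [Letter_a]) F)) $ (l - m))"

lemma a_coeff_add [simp]: "a_coeff k (F + G) = a_coeff k F + a_coeff k G"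
  by (induction k arbitrary: F G)
     (simp_all add: fps_eq_iff plus_ncfps.rep_eq sum.distrib algebra_simps)

lemma a_coeff_diff [simp]: "a_coeff k (F - G) = a_coeff k F - a_coeff k G"
  by (induction k arbitrary: F G)
     (simp_all add: fps_eq_iff minus_ncfps.rep_eq sum_subtractf right_diff_distrib)

lemma a_coeff_smult [simp]: "a_coeff k (nc_smult c F) = fps_const c * a_coeff k F"
  by (induction k arbitrary: F)
     (simp_all add: fps_eq_iff nc_smult.rep_eq sum_distrib_left algebra_simps)

lemma a_coeff_zero [simp]: "a_coeff k 0 = 0"
  using a_coeff_diff[of k 0 0] by simp

lemma a_coeff_0_rec:
  "a_coeff 0 F = fps_const (nc_coeff F []) + fps_X * a_coeff 0 (left_shift [Letter_b] F)"
  by (simp add: fps_eq_iff fps_X_mult_nth left_shift.rep_eq flip: replicate_Suc)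

lemma a_coeff_Suc_rec:
  "a_coeff (Suc k) F = flip (a_coeff k (left_shift [Letter_a] F))
     + fps_X * a_coeff (Suc k) (left_shift [Letter_b] F)"
proof (rule fps_ext)
  fix l
  show "a_coeff (Suc k) F $ l = (flip (a_coeff k (left_shift [Letter_a] F))
     + fps_X * a_coeff (Suc k) (left_shift [Letter_b] F)) $ l"
  proof (cases l)
    case (Suc l')
    have "(\<Sum>m\<le>Suc l'. flip (a_coeff k (left_shift (replicate m Letter_b @ [Letter_a]) F)) $ (Suc l' - m))
       = flip (a_coeff k (left_shift [Letter_a] F)) $ l
         + (\<Sum>m\<le>l'. flip (a_coeff k (left_shift (replicate m Letter_b @ [Letter_a]) (left_shift [Letter_b] F))) $ (l' - m))"
      unfolding sum.atMost_Suc_shift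
      by (simp add: Suc flip: left_shift_append del: flip_nth)
    then show ?thesis by (simp add: Suc fps_X_mult_nth del: flip_nth)
  qed simp
qed

text \<open>The recursion computes the coefficient of \<open>X\<^sup>m\<close> from a coefficient of lower degree at a shifted
argument and a given term \<open>R F\<close>. A product formula for \<open>a_coeff\<close> can thus be proved by checking that both of its sides satisfy
the same recursion in the left factor, without summing over words.\<close>

lemma left_recursion_unique:
  fixes H K :: "(letter, complex) ncfps \<Rightarrow> complex fps"
  assumes H: "\<And>F. H F = R F + fps_X * H (left_shift [Letter_b] F)"
    and K: "\<And>F. K F = R F + fps_X * K (left_shift [Letter_b] F)"
  shows "H F = K F"
proof (rule fps_ext)
  fix m
  show "H F $ m = K F $ m"
    by (induction m arbitrary: F) (subst H, subst K, simp)+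
qed

lemma a_coeff_0_mult: "a_coeff 0 (F * G) = a_coeff 0 F * a_coeff 0 G"
proof (rule left_recursion_unique[where H = "\<lambda>F. a_coeff 0 (F * G)" and K = "\<lambda>F. a_coeff 0 F * a_coeff 0 G"
      and R = "\<lambda>F. fps_const (nc_coeff F []) * a_coeff 0 G"])
  fix F
  show "a_coeff 0 (F * G) = fps_const (nc_coeff F []) * a_coeff 0 G
         + fps_X * a_coeff 0 (left_shift [Letter_b] F * G)"
    by (subst a_coeff_0_rec, subst (2) a_coeff_0_rec)
       (simp add: left_shift_mult algebra_simps del: a_coeff.simps flip: fps_const_mult)
  show "a_coeff 0 F * a_coeff 0 G = fps_const (nc_coeff F []) * a_coeff 0 G
         + fps_X * (a_coeff 0 (left_shift [Letter_b] F) * a_coeff 0 G)"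
    by (subst a_coeff_0_rec) (simp add: algebra_simps del: a_coeff.simps)
qed

lemma a_coeff_1_mult:
  "a_coeff (Suc 0) (F * G)
     = a_coeff 0 F * a_coeff (Suc 0) G + a_coeff (Suc 0) F * flip (a_coeff 0 G)"
proof (rule left_recursion_unique[where H = "\<lambda>F. a_coeff (Suc 0) (F * G)"
      and K = "\<lambda>F. a_coeff 0 F * a_coeff (Suc 0) G + a_coeff (Suc 0) F * flip (a_coeff 0 G)"
      and R = "\<lambda>F. fps_const (nc_coeff F []) * a_coeff (Suc 0) G
                 + flip (a_coeff 0 (left_shift [Letter_a] F)) * flip (a_coeff 0 G)"])
  fix F
  show "a_coeff (Suc 0) (F * G) = fps_const (nc_coeff F []) * a_coeff (Suc 0) G
         + flip (a_coeff 0 (left_shift [Letter_a] F)) * flip (a_coeff 0 G)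
         + fps_X * a_coeff (Suc 0) (left_shift [Letter_b] F * G)"
    by (subst a_coeff_Suc_rec, subst (2) a_coeff_Suc_rec)
       (simp add: left_shift_mult a_coeff_0_mult algebra_simps del: a_coeff.simps)
  show "a_coeff 0 F * a_coeff (Suc 0) G + a_coeff (Suc 0) F * flip (a_coeff 0 G)
       = fps_const (nc_coeff F []) * a_coeff (Suc 0) G
         + flip (a_coeff 0 (left_shift [Letter_a] F)) * flip (a_coeff 0 G)
         + fps_X * (a_coeff 0 (left_shift [Letter_b] F) * a_coeff (Suc 0) G
            + a_coeff (Suc 0) (left_shift [Letter_b] F) * flip (a_coeff 0 G))"
    by (subst a_coeff_0_rec, subst (2) a_coeff_Suc_rec) (simp add: algebra_simps del: a_coeff.simps)
qed

lemma a_coeff_2_mult: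
  "a_coeff 2 (F * G) = a_coeff 0 F * a_coeff 2 G
     + a_coeff (Suc 0) F * flip (a_coeff (Suc 0) G) + a_coeff 2 F * a_coeff 0 G"
  unfolding numeral_2_eq_2
proof (rule left_recursion_unique[where H = "\<lambda>F. a_coeff (Suc (Suc 0)) (F * G)"
      and K = "\<lambda>F. a_coeff 0 F * a_coeff (Suc (Suc 0)) G
        + a_coeff (Suc 0) F * flip (a_coeff (Suc 0) G) + a_coeff (Suc (Suc 0)) F * a_coeff 0 G"
      and R = "\<lambda>F. fps_const (nc_coeff F []) * a_coeff (Suc (Suc 0)) G
        + flip (a_coeff 0 (left_shift [Letter_a] F) * a_coeff (Suc 0) G
              + a_coeff (Suc 0) (left_shift [Letter_a] F) * flip (a_coeff 0 G))"])
  fix F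
  show "a_coeff (Suc (Suc 0)) (F * G) = fps_const (nc_coeff F []) * a_coeff (Suc (Suc 0)) G
         + flip (a_coeff 0 (left_shift [Letter_a] F) * a_coeff (Suc 0) G
              + a_coeff (Suc 0) (left_shift [Letter_a] F) * flip (a_coeff 0 G))
         + fps_X * a_coeff (Suc (Suc 0)) (left_shift [Letter_b] F * G)"
    by (subst a_coeff_Suc_rec, subst (3) a_coeff_Suc_rec)
       (simp add: left_shift_mult a_coeff_1_mult algebra_simps del: a_coeff.simps)
  show "a_coeff 0 F * a_coeff (Suc (Suc 0)) G
        + a_coeff (Suc 0) F * flip (a_coeff (Suc 0) G) + a_coeff (Suc (Suc 0)) F * a_coeff 0 G
       = fps_const (nc_coeff F []) * a_coeff (Suc (Suc 0)) G
         + flip (a_coeff 0 (left_shift [Letter_a] F) * a_coeff (Suc 0) G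
              + a_coeff (Suc 0) (left_shift [Letter_a] F) * flip (a_coeff 0 G))
         + fps_X * (a_coeff 0 (left_shift [Letter_b] F) * a_coeff (Suc (Suc 0)) G
           + a_coeff (Suc 0) (left_shift [Letter_b] F) * flip (a_coeff (Suc 0) G)
           + a_coeff (Suc (Suc 0)) (left_shift [Letter_b] F) * a_coeff 0 G)"
    by (subst a_coeff_0_rec, subst (2) a_coeff_Suc_rec, subst (3) a_coeff_Suc_rec)
       (simp add: algebra_simps del: a_coeff.simps)
qed

section \<open>Power series in b\<close>

text \<open>The image of a commutative power series under \<open>X \<mapsto> b\<close>.\<close>

lift_definition ser :: "'k::zero fps \<Rightarrow> (letter, 'k) ncfps"
  is "\<lambda>p w. if Letter_a \<in> set w then 0 else p $ length w" .

lemma left_shift_ser [simp]: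
  "left_shift [Letter_a] (ser p) = 0"
  by (rule ncfps_eqI; simp add: left_shift.rep_eq ser.rep_eq zero_ncfps.rep_eq)+

lemma ser_add: "ser (p + q) = ser p + ser q"
  and ser_uminus: "ser (- p) = - ser p"
  and ser_1 [simp]: "ser 1 = 1"
  and ser_0 [simp]: "ser 0 = 0"
  and ser_const_mult: "ser (fps_const c * p) = nc_smult c (ser p)"
  by (rule ncfps_eqI; auto simp: ser.rep_eq plus_ncfps.rep_eq minus_ncfps.rep_eq uminus_ncfps.rep_eq
        one_ncfps.rep_eq zero_ncfps.rep_eq nc_smult.rep_eq)+

lemma ser_mult: "ser (p * q) = ser p * ser q"
proof (rule ncfps_eqI)
  fix w
  show "nc_coeff (ser (p * q)) w = nc_coeff (ser p * ser q) w"
  proof (cases "Letter_a \<in> set w")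
    case True
    have "Letter_a \<in> set (drop i w)" if "Letter_a \<notin> set (take i w)" for i
      using True that by (metis Un_iff append_take_drop_id set_append)
    then show ?thesis
      using True by (auto simp: ser.rep_eq times_ncfps.rep_eq intro!: sum.neutral)
  next
    case False
    then show ?thesis
      by (auto simp: ser.rep_eq times_ncfps.rep_eq fps_mult_nth min_def
            dest: in_set_takeD in_set_dropD intro!: sum.cong)
  qed
qed

lemma ser_X: "ser fps_X = nc_var Letter_b"
proof (rule ncfps_eqI)
  fix w :: "letter list"
  consider "w = []" | "w = [Letter_a]" | "w = [Letter_b]" | "length w \<ge> 2"
    by (metis One_nat_def Suc_1 Suc_leI length_0_conv length_Suc_conv less_2_cases letter.exhaust linorder_not_less)
  then show "nc_coeff (ser fps_X) w = (nc_coeff (nc_var Letter_b) w :: 'a)"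
    by cases (auto simp: ser.rep_eq nc_var.rep_eq fps_X_def)
qed

lemma ser_power: "ser (p ^ k) = ser p ^ k"
  by (induction k) (auto simp: ser_mult)

lemma ser_X_power: "ser (fps_X ^ k) = nc_var Letter_b ^ k"
  by (simp add: ser_power ser_X)

lemma a_coeff_ser [simp]: "a_coeff 0 (ser p) = p" "a_coeff (Suc k) (ser p) = 0" "a_coeff 2 (ser p) = 0"
  "a_coeff (Suc 0) (ser p) = 0"
proof -
  show *: "a_coeff 0 (ser p) = p"
    by (simp add: fps_eq_iff ser.rep_eq)
  show **: "a_coeff (Suc k) (ser p) = 0" for k
  proof -
    have "left_shift (replicate m Letter_b @ [Letter_a]) (ser p) = 0" for m
      by (rule ncfps_eqI) (simp add: left_shift.rep_eq ser.rep_eq zero_ncfps.rep_eq)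
    then show ?thesis by (simp add: fps_eq_iff)
  qed
  show "a_coeff 2 (ser p) = 0"
    using ** by (simp only: numeral_2_eq_2)
  show "a_coeff (Suc 0) (ser p) = 0" by (rule **)
qed

lemma a_coeff_var_a [simp]:
  "a_coeff 0 ser_a = 0" "a_coeff (Suc 0) ser_a = 1" "a_coeff 2 ser_a = 0"
proof -
  have *: "left_shift [Letter_b] ser_a = 0" "left_shift [Letter_a] ser_a = ser 1"
    by (simp_all add: left_shift_var)
  show "a_coeff 0 ser_a = 0"
    by (subst a_coeff_0_rec) (simp add: * nc_var.rep_eq del: a_coeff.simps)
  show "a_coeff (Suc 0) ser_a = 1"
    by (subst a_coeff_Suc_rec) (simp add: * del: a_coeff.simps ser_1)
  show "a_coeff 2 ser_a = 0" unfolding numeral_2_eq_2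
    by (subst a_coeff_Suc_rec) (simp add: * del: a_coeff.simps ser_1)
qed

declare a_coeff.simps [simp del]

section \<open>The ideal of relations and a multiplicative pair of coordinates\<close>

text \<open>The condition on \<open>i\<close> makes the even term of \<open>f\<close>, if there is one, of higher order than the odd term.\<close>

locale A_algebra =
  fixes n i :: nat
  assumes index: "i = 0 \<or> n < i" and n_pos: "1 \<le> n"
begin

definition N :: nat where
  "N = 2 * n + 1"

definition f :: "complex fps" where
  "f = fps_X ^ N + (if i = 0 then 0 else fps_X ^ (2 * i))"

definition rels :: "(letter, complex) ncfps set" where
  "rels = {ser_a * ser_b + ser_b * ser_a, ser_a ^ 2 + ser f}"

definition I :: "(letter, complex) ncfps set" where
  "I = genideal class_ring rels"

text \<open>The coordinates of the class of \<open>F\<close>: it equals \<open>p(b) + q(b) a\<close> with \<open>p = b_part F\<close> and \<open>q = a_part F\<close>. They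
come from the twisted expansion by putting \<open>a\<^sup>2 = - f\<close> and dropping \<open>a\<^sup>k\<close> for \<open>k \<ge> 3\<close>. Only
\<open>p\<close> modulo \<open>X\<^sup>2\<^sup>N\<close> and \<open>q\<close> modulo \<open>X\<^sup>N\<close> depend on the class alone.\<close>

definition b_part :: "(letter, complex) ncfps \<Rightarrow> complex fps" where
  "b_part F = a_coeff 0 F - f * a_coeff 2 F"

definition a_part :: "(letter, complex) ncfps \<Rightarrow> complex fps" where
  "a_part F = a_coeff (Suc 0) F"

lemma f_ser: "ser f = ser_b ^ N + (if i = 0 then 0 else ser_b ^ (2 * i))"
  by (simp add: f_def ser_add ser_X_power)

lemma alg_A_eq: "alg_A n i = nc_quotient rels"
  by (simp add: alg_A_def rels_def f_ser N_def add.assoc[symmetric] del: power_Suc)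

lemma I_ideal: "ideal I class_ring"
  unfolding I_def by (rule nc_ideal)

lemma I_add: "F \<in> I \<Longrightarrow> G \<in> I \<Longrightarrow> F + G \<in> I"
  using additive_subgroup.a_closed[OF ideal.axioms(1)[OF I_ideal]] by simp

lemma I_mult_left: "F \<in> I \<Longrightarrow> G * F \<in> I"
  using ideal.I_l_closed[OF I_ideal] by simp

lemma I_mult_right: "F \<in> I \<Longrightarrow> F * G \<in> I"
  using ideal.I_r_closed[OF I_ideal] by simp

lemma I_zero: "0 \<in> I"
  using additive_subgroup.zero_closed[OF ideal.axioms(1)[OF I_ideal]] by simp

lemma I_uminus: "F \<in> I \<Longrightarrow> - F \<in> I"
  using I_mult_left[of F "- 1"] by simp

lemma I_diff: "F \<in> I \<Longrightarrow> G \<in> I \<Longrightarrow> F - G \<in> I"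
  using I_add[of F "- G"] I_uminus[of G] by simp

lemma I_smult: "F \<in> I \<Longrightarrow> nc_smult c F \<in> I"
  by (subst nc_smult_conv_mult) (rule I_mult_left)

lemma I_diff_trans: "F - G \<in> I \<Longrightarrow> G - H \<in> I \<Longrightarrow> F - H \<in> I"
  using I_add[of "F - G" "G - H"] by simp

lemma rel_commute: "ser_a * ser_b + ser_b * ser_a \<in> I"
  and rel_square: "ser_a ^ 2 + ser f \<in> I"
  using ring.genideal_self[OF class_ring.ring_axioms, of rels] by (auto simp: I_def rels_def)

lemma X_power_dvd_f: "fps_X ^ N dvd f"
proof -
  have "(fps_X :: complex fps) ^ N dvd fps_X ^ (2 * i)" if "n < i"
    by (rule le_imp_power_dvd) (use that in \<open>simp add: N_def\<close>)
  then show ?thesis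
    using index unfolding f_def by (intro dvd_add) auto
qed

lemma X_power_double: "(fps_X :: complex fps) ^ (2 * N) = fps_X ^ N * fps_X ^ N"
  by (simp add: mult_2 power_add)

text \<open>The product formulas are those of
\<open>(p + q a)(p' + q' a) = (p p' - f q flip(q')) + (p q' + q flip(p')) a\<close>. The error in the first coordinate
is a multiple of \<open>f\<^sup>2\<close>, since it stems from \<open>a\<^sup>4\<close>; the error in the second is a multiple of \<open>f\<close> or \<open>flip f\<close>, since
it stems from \<open>a\<^sup>3\<close>.\<close>

lemma b_part_mult:
  "fps_X ^ (2 * N) dvd b_part (F * G) - (b_part F * b_part G - f * a_part F * flip (a_part G))"
proof -
  have "b_part (F * G) - (b_part F * b_part G - f * a_part F * flip (a_part G)) = - (f * f) * (a_coeff 2 F * a_coeff 2 G)"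
    by (simp add: b_part_def a_part_def a_coeff_0_mult a_coeff_2_mult algebra_simps)
  moreover have "fps_X ^ (2 * N) dvd f * f"
    unfolding X_power_double by (rule mult_dvd_mono[OF X_power_dvd_f X_power_dvd_f])
  ultimately show ?thesis by simp
qed

lemma a_part_mult:
  "fps_X ^ N dvd a_part (F * G) - (b_part F * a_part G + a_part F * flip (b_part G))"
proof -
  have "a_part (F * G) - (b_part F * a_part G + a_part F * flip (b_part G))
      = f * (a_coeff 2 F * a_part G) + flip f * (a_part F * flip (a_coeff 2 G))"
    by (simp add: b_part_def a_part_def a_coeff_1_mult algebra_simps)
  moreover have "fps_X ^ N dvd flip f"
    unfolding X_power_dvd_flip by (rule X_power_dvd_f)
  ultimately show ?thesis
    using X_power_dvd_f by (simp add: dvd_add)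
qed

lemma b_part_linear [simp]: "b_part (F + G) = b_part F + b_part G" "b_part (F - G) = b_part F - b_part G"
    "b_part (nc_smult c F) = fps_const c * b_part F" "b_part 0 = 0"
  and a_part_linear [simp]: "a_part (F + G) = a_part F + a_part G" "a_part (F - G) = a_part F - a_part G"
    "a_part (nc_smult c F) = fps_const c * a_part F" "a_part 0 = 0"
  by (simp_all add: b_part_def a_part_def algebra_simps)

lemma b_part_ser [simp]: "b_part (ser p) = p" and a_part_ser [simp]: "a_part (ser p) = 0"
  by (simp_all add: b_part_def a_part_def)

lemma b_part_var_a [simp]: "b_part ser_a = 0" and a_part_var_a [simp]: "a_part ser_a = 1"
  by (simp_all add: b_part_def a_part_def)

lemma b_part_ser_mult_a [simp]: "b_part (ser p * ser_a) = 0"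
  and a_part_ser_mult_a [simp]: "a_part (ser p * ser_a) = p"
  by (simp_all add: b_part_def a_part_def a_coeff_0_mult a_coeff_1_mult a_coeff_2_mult)

text \<open>The series with vanishing coordinates. That this is the ideal of relations is the theorem \<open>I_eq_K\<close>.\<close>

definition K :: "(letter, complex) ncfps set" where
  "K = {F. fps_X ^ (2 * N) dvd b_part F \<and> fps_X ^ N dvd a_part F}"

lemma K_mult:
  assumes "F \<in> K \<or> G \<in> K"
  shows "F * G \<in> K"
proof -
  have le: "(fps_X :: complex fps) ^ N dvd fps_X ^ (2 * N)"
    by (rule le_imp_power_dvd) simp
  have uF: "fps_X ^ N dvd b_part F" if "F \<in> K" for F
    using that dvd_trans[OF le] by (auto simp: K_def)
  have vv: "fps_X ^ (2 * N) dvd f * (a_part F * flip (a_part G))"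
    unfolding X_power_double
  proof (rule mult_dvd_mono[OF X_power_dvd_f])
    have "fps_X ^ N dvd a_part F \<or> fps_X ^ N dvd flip (a_part G)"
      using assms unfolding K_def X_power_dvd_flip by blast
    then show "fps_X ^ N dvd a_part F * flip (a_part G)"
      by (rule disjE) (rule dvd_mult2 dvd_mult, assumption)+
  qed
  have "fps_X ^ (2 * N) dvd b_part F * b_part G - f * a_part F * flip (a_part G)"
    using assms vv by (intro dvd_diff) (auto simp: K_def mult.assoc)
  then have "fps_X ^ (2 * N) dvd b_part (F * G)"
    using dvd_add[OF b_part_mult[of F G]] by fastforce
  moreover have "fps_X ^ N dvd b_part F * a_part G + a_part F * flip (b_part G)"
    using assms
  proof
    assume "F \<in> K"
    then show ?thesis using uF by (simp add: K_def)
  next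
    assume "G \<in> K"
    then show ?thesis using uF[of G] by (simp add: K_def)
  qed
  then have "fps_X ^ N dvd a_part (F * G)"
    using dvd_add[OF a_part_mult[of F G]] by fastforce
  ultimately show ?thesis by (simp add: K_def)
qed

lemma K_ideal: "ideal K class_ring"
proof (rule idealI)
  show "ring (class_ring :: (letter, complex) ncfps ring)"
    by (rule class_ring.ring_axioms)
  show "subgroup K (add_monoid (class_ring :: (letter, complex) ncfps ring))"
  proof (rule group.subgroupI)
    show "Group.group (add_monoid (class_ring :: (letter, complex) ncfps ring))"
      by (rule abelian_group.a_group[OF ring.is_abelian_group[OF class_ring.ring_axioms]])
    have "0 \<in> K" by (simp add: K_def)
    then show "K \<noteq> {}" by blast
    fix F assume "F \<in> K"
    then have "- F \<in> K"
      using b_part_linear(2)[of 0 F] a_part_linear(2)[of 0 F] by (simp add: K_def del: power_Suc)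
    moreover have "inv\<^bsub>add_monoid (class_ring :: (letter, complex) ncfps ring)\<^esub> F = - F"
      using class_ring_simps unfolding a_inv_def by metis
    ultimately show "inv\<^bsub>add_monoid (class_ring :: (letter, complex) ncfps ring)\<^esub> F \<in> K"
      by (simp only:)
  next
    fix F G assume "F \<in> K" "G \<in> K"
    then show "F \<otimes>\<^bsub>add_monoid (class_ring :: (letter, complex) ncfps ring)\<^esub> G \<in> K"
      by (simp add: K_def del: power_Suc)
  qed simp
qed (simp_all add: K_mult)

lemma I_subset_K: "I \<subseteq> K"
  unfolding I_def
proof (rule ring.genideal_minimal[OF class_ring.ring_axioms K_ideal])
  show "rels \<subseteq> K"
    by (auto simp: rels_def K_def b_part_def a_part_def a_coeff_0_mult a_coeff_1_mult a_coeff_2_mult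
        power2_eq_square simp flip: ser_X)
qed

lemma N_ge_3: "3 \<le> N"
  using n_pos by (simp add: N_def)

lemma f_nth: "f $ k = (if k = N then 1 else 0) + (if i \<noteq> 0 \<and> k = 2 * i then 1 else 0)"
  by (simp add: f_def fps_X_power_nth)

section \<open>Every series is p(b) + q(b) a modulo the relations\<close>

lemma commute_power:
  "if even j then ser_a * ser_b ^ j - ser_b ^ j * ser_a \<in> I
   else ser_a * ser_b ^ j + ser_b ^ j * ser_a \<in> I"
proof (induction j)
  case (Suc j)
  note R = I_mult_right[OF rel_commute, of "ser_b ^ j"]
  show ?case
  proof (cases "even j")
    case True
    then have "ser_b * (ser_a * ser_b ^ j - ser_b ^ j * ser_a) \<in> I"
      using Suc I_mult_left by simp
    from I_diff[OF R this] show ?thesis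
      using True by (simp add: algebra_simps)
  next
    case False
    then have "ser_b * (ser_a * ser_b ^ j + ser_b ^ j * ser_a) \<in> I"
      using Suc I_mult_left by simp
    from I_diff[OF R this] show ?thesis
      using False by (simp add: algebra_simps)
  qed
qed (simp add: I_zero)

lemma commute_f: "ser_a * ser f - ser f * ser_a \<in> I"
  using I_diff[OF I_mult_left[OF rel_square, of ser_a] I_mult_right[OF rel_square, of ser_a]]
  by (simp add: algebra_simps power2_eq_square)

text \<open>Both \<open>a\<^sup>2\<close> and the even powers of \<open>b\<close> commute with \<open>a\<close>, hence so does \<open>b\<^sup>N\<close>, which also anticommutes with \<open>a\<close>
because \<open>N\<close> is odd.\<close>

lemma b_power_a: "ser_b ^ N * ser_a \<in> I"
proof -
  define e where "e = (if i = 0 then 0 else ser_b ^ (2 * i))"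
  have f: "ser f = ser_b ^ N + e"
    by (simp add: f_ser e_def)
  have e: "ser_a * e - e * ser_a \<in> I"
    using commute_power[of "2 * i"] I_zero unfolding e_def by (cases "i = 0") simp_all
  have "ser_a * ser_b ^ N + ser_b ^ N * ser_a \<in> I"
    using commute_power[of N] by (simp add: N_def)
  from I_add[OF this e] have "ser_b ^ N * ser_a + ser_b ^ N * ser_a \<in> I"
    using I_diff[OF _ commute_f] by (fastforce simp: f algebra_simps)
  then have "nc_smult (1 / 2) (ser_b ^ N * ser_a + ser_b ^ N * ser_a) \<in> I"
    by (rule I_smult)
  then show ?thesis
    unfolding nc_smult_simps(2) nc_smult_simps(1)[symmetric] by (simp add: nc_smult_simps)
qed

text \<open>As \<open>b\<^sup>N a\<^sup>2 = 0\<close>, multiplying \<open>a\<^sup>2 + f(b)\<close> by \<open>b\<^sup>N\<close> leaves \<open>b\<^sup>N f(b) = b\<^sup>2\<^sup>N g(b)\<close> with \<open>g\<close> a unit.\<close>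

lemma b_power_0: "ser_b ^ (2 * N) \<in> I"
proof -
  obtain g where g: "f = fps_X ^ N * g"
    using X_power_dvd_f by (rule dvdE)
  have "g $ 0 = f $ N"
    by (simp add: g fps_X_power_mult_nth)
  then have g0: "g $ 0 \<noteq> 0"
    by (auto simp: f_nth N_def)
  have "ser_b ^ N * (ser_a ^ 2 + ser f) - ser_b ^ N * ser_a * ser_a \<in> I"
    by (intro I_diff I_mult_left[OF rel_square] I_mult_right[OF b_power_a])
  then have "ser_b ^ N * ser f \<in> I"
    by (simp add: algebra_simps power2_eq_square)
  then have "ser_b ^ N * ser f * ser (inverse g) \<in> I"
    by (rule I_mult_right)
  moreover have "fps_X ^ N * f * inverse g = fps_X ^ (2 * N)"
    using inverse_mult_eq_1[OF g0] by (simp add: g mult_2 power_add mult.assoc) (metis mult.commute mult_1_right)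
  ultimately show ?thesis
    by (simp flip: ser_X_power ser_mult)
qed

lemma ser_in_I: "fps_X ^ (2 * N) dvd p \<Longrightarrow> ser p \<in> I"
  by (auto elim!: dvdE simp: ser_mult ser_X_power intro: I_mult_right[OF b_power_0])

lemma ser_a_in_I:
  assumes "fps_X ^ N dvd p"
  shows "ser p * ser_a \<in> I"
proof -
  obtain q where "p = q * fps_X ^ N"
    using assms by (metis dvdE mult.commute)
  then show ?thesis
    by (simp add: ser_mult ser_X_power mult.assoc I_mult_left[OF b_power_a])
qed

text \<open>The relation \<open>a p(b) = p(-b) a\<close> is not obtained term by term from \<open>a b = - b a\<close>, because the ideal need not
contain infinite sums of its elements. Instead, the lowest term of \<open>p\<close> is split off until only
a multiple of \<open>X\<^sup>2\<^sup>N\<close> remains, which lies in the ideal.\<close>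

lemma commute_ser: "ser_a * ser p - ser (flip p) * ser_a \<in> I"
proof -
  have "fps_X ^ m dvd p \<Longrightarrow> ser_a * ser p - ser (flip p) * ser_a \<in> I" if "m \<le> 2 * N" for m p
    using that
  proof (induction m arbitrary: p rule: inc_induct)
    case base
    then have "fps_X ^ (2 * N) dvd flip p" by simp
    then show ?case
      using base by (intro I_diff I_mult_left I_mult_right ser_in_I)
  next
    case (step m)
    define c p' where "c = p $ m" and "p' = p - fps_const c * fps_X ^ m"
    have "fps_X ^ Suc m dvd p'"
      using step.prems unfolding fps_X_power_dvd_iff
      by (auto simp: p'_def c_def fps_X_power_nth less_Suc_eq)
    then have p': "ser_a * ser p' - ser (flip p') * ser_a \<in> I"
      by (rule step.IH)
    have "ser_a * ser (fps_X ^ m) - ser (flip (fps_X ^ m)) * ser_a \<in> I"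
      using commute_power[of m]
      by (auto simp: ser_X_power ser_uminus power_minus_odd split: if_splits)
    from I_smult[OF this, of c]
    have X: "ser_a * ser (fps_const c * fps_X ^ m) - ser (flip (fps_const c * fps_X ^ m)) * ser_a \<in> I"
      by (simp add: ser_const_mult nc_smult_mult_left nc_smult_diff flip: nc_smult_mult_right)
    have p: "p = p' + fps_const c * fps_X ^ m" by (simp add: p'_def)
    show ?case
      using I_add[OF p' X] unfolding p flip_add ser_add by (simp add: algebra_simps)
  qed
  from this[of 0] show ?thesis by simp
qed

definition normalizable :: "(letter, complex) ncfps \<Rightarrow> bool" where
  "normalizable F \<longleftrightarrow> (\<exists>p q. F - (ser p + ser q * ser_a) \<in> I)"

text \<open>If \<open>F\<close> is \<open>p(b) + q(b) a\<close> modulo the ideal, then \<open>p\<close> and \<open>q\<close> agree with its coordinates to the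
relevant orders; when these vanish, \<open>p(b)\<close> and \<open>q(b) a\<close> are in the ideal.\<close>

lemma normalizable_K_imp_I:
  assumes "normalizable F" "F \<in> K"
  shows "F \<in> I"
proof -
  obtain p q where pq: "F - (ser p + ser q * ser_a) \<in> I"
    using assms(1) by (auto simp: normalizable_def)
  then have "F - (ser p + ser q * ser_a) \<in> K"
    using I_subset_K by blast
  then have p: "fps_X ^ (2 * N) dvd b_part F - p" and q: "fps_X ^ N dvd a_part F - q"
    by (simp_all add: K_def)
  have "fps_X ^ (2 * N) dvd p" "fps_X ^ N dvd q"
    using dvd_diff[OF _ p, of "b_part F"] dvd_diff[OF _ q, of "a_part F"] assms(2) by (simp_all add: K_def)
  then have "ser p + ser q * ser_a \<in> I"
    by (intro I_add ser_in_I ser_a_in_I)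
  from I_add[OF pq this] show ?thesis by simp
qed

lemma normalizable_add:
  assumes "normalizable F" "normalizable G"
  shows "normalizable (F + G)"
proof -
  obtain p q p' q' where "F - (ser p + ser q * ser_a) \<in> I" "G - (ser p' + ser q' * ser_a) \<in> I"
    using assms by (auto simp: normalizable_def)
  from I_add[OF this] have "F + G - (ser (p + p') + ser (q + q') * ser_a) \<in> I"
    by (simp add: ser_add algebra_simps)
  then show ?thesis unfolding normalizable_def by blast
qed

lemma normalizable_smult:
  assumes "normalizable F"
  shows "normalizable (nc_smult c F)"
proof -
  obtain p q where "F - (ser p + ser q * ser_a) \<in> I"
    using assms by (auto simp: normalizable_def)
  from I_smult[OF this, of c]
  have "nc_smult c F - (ser (fps_const c * p) + ser (fps_const c * q) * ser_a) \<in> I"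
    by (simp add: ser_const_mult nc_smult_diff nc_smult_simps nc_smult_mult_left)
  then show ?thesis unfolding normalizable_def by blast
qed

lemma normalizable_I: "F \<in> I \<Longrightarrow> normalizable F"
  unfolding normalizable_def by (rule exI[of _ 0], rule exI[of _ 0]) simp

lemma normalizable_b_mult:
  assumes "normalizable F"
  shows "normalizable (ser_b * F)"
proof -
  obtain p q where "F - (ser p + ser q * ser_a) \<in> I"
    using assms by (auto simp: normalizable_def)
  from I_mult_left[OF this, of ser_b]
  have "ser_b * F - (ser (fps_X * p) + ser (fps_X * q) * ser_a) \<in> I"
    by (simp add: ser_mult ser_X algebra_simps)
  then show ?thesis unfolding normalizable_def by blast
qed

lemma normalizable_a_mult:
  assumes "normalizable F"
  shows "normalizable (ser_a * F)"
proof -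
  obtain p q where "F - (ser p + ser q * ser_a) \<in> I"
    using assms by (auto simp: normalizable_def)
  then have 1: "ser_a * F - ser_a * (ser p + ser q * ser_a) \<in> I"
    using I_mult_left by (simp flip: right_diff_distrib)
  have "(ser_a * ser p - ser (flip p) * ser_a) + (ser_a * ser q - ser (flip q) * ser_a) * ser_a
      + ser (flip q) * (ser_a ^ 2 + ser f) \<in> I"
    by (intro I_add I_mult_right I_mult_left commute_ser rel_square)
  then have "ser_a * (ser p + ser q * ser_a) - (ser (- (flip q * f)) + ser (flip p) * ser_a) \<in> I"
    by (simp add: algebra_simps power2_eq_square ser_mult ser_uminus)
  from I_diff_trans[OF 1 this] show ?thesis
    unfolding normalizable_def by blast
qed

definition word :: "letter list \<Rightarrow> (letter, complex) ncfps" where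
  "word w = prod_list (map nc_var w)"

lemma normalizable_word: "normalizable (word w)"
proof (induction w)
  case Nil
  have "(1 :: (letter, complex) ncfps) - (ser 1 + ser 0 * ser_a) \<in> I"
    by (simp add: I_zero)
  then show ?case
    unfolding word_def normalizable_def list.map prod_list.Nil by (intro exI)
next
  case (Cons x w)
  then show ?case
    by (cases x) (auto simp: word_def intro: normalizable_a_mult normalizable_b_mult)
qed

text \<open>The filtration of the quotient by powers of its maximal ideal \<open>(a, b)\<close>: both letters have weight \<open>1\<close>. The
exponents are capped at the orders up to which the coordinates are meaningful.\<close>

definition weight_ge :: "nat \<Rightarrow> (letter, complex) ncfps \<Rightarrow> bool" where
  "weight_ge d F \<longleftrightarrow> fps_X ^ min d (2 * N) dvd b_part F \<and> fps_X ^ min (d - 1) N dvd a_part F"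

text \<open>Replacing \<open>a\<^sup>2\<close>, of weight \<open>2\<close>, by \<open>- f(b)\<close>, of order \<open>N \<ge> 3\<close>, cannot lower the weight.\<close>

lemma weight_ge_mult:
  assumes "weight_ge d F" "weight_ge e G"
  shows "weight_ge (d + e) (F * G)"
proof -
  note F = assms(1)[unfolded weight_ge_def] and G = assms(2)[unfolded weight_ge_def]
  have 1: "fps_X ^ min (d + e) (2 * N) dvd b_part F * b_part G"
    using F G by (auto intro: X_power_dvd_mult)
  have vv: "fps_X ^ (min (d - 1) N + min (e - 1) N) dvd a_part F * flip (a_part G)"
    using F G by (auto intro: X_power_dvd_mult)
  have 2: "fps_X ^ min (d + e) (2 * N) dvd f * (a_part F * flip (a_part G))"
    by (rule X_power_dvd_mult[OF X_power_dvd_f vv]) (use N_ge_3 in auto)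
  have "fps_X ^ min (d + e) (2 * N) dvd b_part (F * G) - (b_part F * b_part G - f * a_part F * flip (a_part G))"
    by (rule dvd_trans[OF le_imp_power_dvd b_part_mult]) simp
  from dvd_add[OF this dvd_diff[OF 1 2]]
  have U: "fps_X ^ min (d + e) (2 * N) dvd b_part (F * G)"
    by (simp add: mult.assoc)
  have 3: "fps_X ^ min (d + e - 1) N dvd b_part F * a_part G"
    by (rule X_power_dvd_mult[OF conjunct1[OF F] conjunct2[OF G]]) auto
  have "fps_X ^ min e (2 * N) dvd flip (b_part G)" using G by simp
  then have 4: "fps_X ^ min (d + e - 1) N dvd a_part F * flip (b_part G)"
    by (rule X_power_dvd_mult[OF conjunct2[OF F]]) auto
  have "fps_X ^ min (d + e - 1) N dvd a_part (F * G) - (b_part F * a_part G + a_part F * flip (b_part G))"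
    by (rule dvd_trans[OF le_imp_power_dvd a_part_mult]) simp
  from dvd_add[OF this dvd_add[OF 3 4]]
  have V: "fps_X ^ min (d + e - 1) N dvd a_part (F * G)" by simp
  show ?thesis using U V by (simp add: weight_ge_def)
qed

lemma weight_ge_0: "weight_ge 0 F"
  by (simp add: weight_ge_def)

lemma weight_ge_power: "weight_ge d F \<Longrightarrow> weight_ge (d * m) (F ^ m)"
proof (induction m)
  case (Suc m)
  then show ?case using weight_ge_mult[of d F "d * m" "F ^ m"] by simp
qed (simp add: weight_ge_0)

lemma weight_ge_imp_K:
  assumes "weight_ge d F" "2 * N \<le> d"
  shows "F \<in> K"
proof -
  have "min d (2 * N) = 2 * N" "min (d - 1) N = N"
    using assms(2) N_ge_3 by auto
  then show ?thesis
    using assms(1) by (simp add: weight_ge_def K_def)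
qed

lemma weight_ge_word: "weight_ge (length w) (word w)"
proof (induction w)
  case (Cons x w)
  have "weight_ge 1 (nc_var x)"
  proof (cases x)
    case Letter_b
    have "b_part ser_b = fps_X" "a_part ser_b = 0" by (simp_all flip: ser_X)
    then show ?thesis using Letter_b N_ge_3 by (simp add: weight_ge_def min_def)
  qed (simp add: weight_ge_def)
  from weight_ge_mult[OF this Cons] show ?case by (simp add: word_def)
qed (simp add: weight_ge_0)

text \<open>Splitting off first letters \<open>2N\<close> times writes \<open>F\<close> as a polynomial plus finitely many products that begin
with a word of length \<open>2N\<close>. Such words have weight \<open>2N\<close>, hence lie in the ideal.\<close>

lemma normalizable: "normalizable F"
proof -
  have "normalizable (word w * F)" if "l + length w = 2 * N" for l w F
    using that
  proof (induction l arbitrary: w F)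
    case 0
    then have "word w \<in> K"
      using weight_ge_imp_K[OF weight_ge_word] by simp
    then have "word w \<in> I"
      by (rule normalizable_K_imp_I[OF normalizable_word])
    then show ?case
      by (intro normalizable_I I_mult_right)
  next
    case (Suc l)
    have "word w * F = nc_smult (nc_coeff F []) (word w)
        + word (w @ [Letter_a]) * left_shift [Letter_a] F
        + word (w @ [Letter_b]) * left_shift [Letter_b] F"
      by (subst first_letter_expansion[of F])
         (simp add: word_def distrib_left mult.assoc flip: nc_smult_mult_right)
    then show ?case
      using Suc by (auto intro!: normalizable_add normalizable_smult normalizable_word)
  qed
  from this[of "2 * N" "[]" F] show ?thesis by (simp add: word_def)
qed

theorem I_eq_K: "I = K"
  using I_subset_K normalizable_K_imp_I[OF normalizable] by blast

section \<open>The dimension\<close>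

definition cls :: "(letter, complex) ncfps \<Rightarrow> (letter, complex) ncfps set" where
  "cls F = I +>\<^bsub>class_ring\<^esub> F"

lemma cls_eq_iff: "cls F = cls G \<longleftrightarrow> F - G \<in> I"
proof
  assume "F - G \<in> I"
  then show "cls F = cls G"
    unfolding cls_def I_def by (rule nc_coset_cong)
next
  assume "cls F = cls G"
  moreover have "F \<in> cls F"
    unfolding cls_def I_def nc_coset_eq using I_zero by (auto simp: I_def intro!: exI[of _ 0])
  ultimately obtain x where "F = x + G" "x \<in> I"
    unfolding cls_def I_def nc_coset_eq by blast
  then show "F - G \<in> I" by simp
qed

lemma carrier_alg_A: "carrier (alg_A n i) = range cls"
  unfolding alg_A_eq cls_def I_def by (rule nc_carrier)

lemma cls_in_carrier [simp]: "cls F \<in> carrier (alg_A n i)"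
  by (simp add: carrier_alg_A)

lemma cls_zero: "\<zero>\<^bsub>alg_A n i\<^esub> = cls 0"
proof -
  have "\<zero>\<^bsub>alg_A n i\<^esub> = I"
    by (simp add: alg_A_eq nc_quotient_def Let_def FactRing_def I_def)
  also have "I = cls 0"
    unfolding cls_def I_def nc_coset_eq by simp
  finally show ?thesis .
qed

lemma cls_add: "cls F \<oplus>\<^bsub>alg_A n i\<^esub> cls G = cls (F + G)"
  and cls_mult: "cls F \<otimes>\<^bsub>alg_A n i\<^esub> cls G = cls (F * G)"
  and cls_smult: "c \<odot>\<^bsub>alg_A n i\<^esub> cls F = cls (nc_smult c F)"
  unfolding alg_A_eq cls_def I_def by (rule nc_quotient_add nc_quotient_mult nc_quotient_smult)+

lemma alg_A_vectorspace: "vectorspace class_ring (alg_A n i)"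
  unfolding alg_A_eq by (rule nc_quotient_vectorspace)

definition monomial :: "nat \<Rightarrow> (letter, complex) ncfps" where
  "monomial k = (if k < 2 * N then ser (fps_X ^ k) else ser (fps_X ^ (k - 2 * N)) * ser_a)"

definition lin :: "(nat \<Rightarrow> complex) \<Rightarrow> (letter, complex) ncfps" where
  "lin c = (\<Sum>k<3 * N. nc_smult (c k) (monomial k))"

lemma b_part_sum: "b_part (sum g A) = (\<Sum>k\<in>A. b_part (g k))" and a_part_sum: "a_part (sum g A) = (\<Sum>k\<in>A. a_part (g k))"
  by (induction A rule: infinite_finite_induct; simp)+

lemma b_part_lin: "j < 2 * N \<Longrightarrow> b_part (lin c) $ j = c j"
proof -
  assume j: "j < 2 * N"
  have "b_part (lin c) $ j = (\<Sum>k<3 * N. if k = j then c j else 0)"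
    unfolding lin_def b_part_sum fps_sum_nth
    by (rule sum.cong) (use j in \<open>auto simp: monomial_def fps_X_power_nth\<close>)
  then show ?thesis using j by simp
qed

lemma a_part_lin: "j < N \<Longrightarrow> a_part (lin c) $ j = c (2 * N + j)"
proof -
  assume j: "j < N"
  have "a_part (lin c) $ j = (\<Sum>k<3 * N. if k = 2 * N + j then c (2 * N + j) else 0)"
    unfolding lin_def a_part_sum fps_sum_nth
    by (rule sum.cong) (use j in \<open>auto simp: monomial_def fps_X_power_nth\<close>)
  then show ?thesis using j by simp
qed

lemma lin_in_I_iff: "lin c \<in> I \<longleftrightarrow> (\<forall>k<3 * N. c k = 0)"
proof
  assume "lin c \<in> I"
  then have "lin c \<in> K" by (simp add: I_eq_K)
  then have *: "\<forall>k<2 * N. c k = 0" "\<forall>k<N. c (2 * N + k) = 0"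
    unfolding K_def fps_X_power_dvd_iff by (auto simp: b_part_lin a_part_lin)
  show "\<forall>k<3 * N. c k = 0"
  proof (intro allI impI)
    fix k assume "k < 3 * N"
    then show "c k = 0"
      using *(1)[rule_format, of k] *(2)[rule_format, of "k - 2 * N"] by (cases "k < 2 * N") auto
  qed
next
  assume "\<forall>k<3 * N. c k = 0"
  then have "lin c \<in> K"
    unfolding K_def fps_X_power_dvd_iff by (auto simp: b_part_lin a_part_lin)
  then show "lin c \<in> I" by (simp add: I_eq_K)
qed

lemma exists_lin: "\<exists>c. F - lin c \<in> I"
proof -
  define c where "c k = (if k < 2 * N then b_part F $ k else a_part F $ (k - 2 * N))" for k
  have "F - lin c \<in> K"
    unfolding K_def fps_X_power_dvd_iff by (auto simp: b_part_lin a_part_lin) (auto simp: c_def)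
  then show ?thesis by (auto simp: I_eq_K)
qed

lemma inj_cls_monomial: "inj_on (\<lambda>k. cls (monomial k)) {..<3 * N}"
proof (rule inj_onI, rule ccontr)
  fix k l assume kl: "k \<in> {..<3 * N}" "l \<in> {..<3 * N}" "cls (monomial k) = cls (monomial l)" "k \<noteq> l"
  define c :: "nat \<Rightarrow> complex" where "c j = (if j = k then 1 else if j = l then - 1 else 0)" for j
  have "lin c = (\<Sum>j\<in>{..<3 * N}. (if j = k then monomial k else 0) - (if j = l then monomial l else 0))"
    unfolding lin_def using kl(4)
    by (intro sum.cong) (auto simp: c_def nc_smult_uminus nc_smult_zero nc_smult_simps)
  also have "\<dots> = monomial k - monomial l"
    using kl by (simp add: sum_subtractf)
  also have "\<dots> \<in> I"
    using kl cls_eq_iff by blast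
  finally show False
    using kl lin_in_I_iff by (auto simp: c_def split: if_splits)
qed

lemma lincomb_cls:
  "module.lincomb (alg_A n i) c ((\<lambda>k. cls (monomial k)) ` {..<3 * N})
     = cls (lin (\<lambda>k. c (cls (monomial k))))"
proof -
  interpret V: vectorspace class_ring "alg_A n i" by (rule alg_A_vectorspace)
  have "V.lincomb c ((\<lambda>k. cls (monomial k)) ` J)
     = cls (\<Sum>k\<in>J. nc_smult (c (cls (monomial k))) (monomial k))" if "J \<subseteq> {..<3 * N}" for J
  proof -
    have "finite J" using that finite_subset by blast
    then show ?thesis using that
    proof (induction J)
      case empty
      then show ?case by (simp add: V.lincomb_def cls_zero)
    next
      case (insert k J)
      have "cls (monomial k) \<notin> (\<lambda>k. cls (monomial k)) ` J"
        using insert inj_on_image_mem_iff[OF inj_cls_monomial, of k J] by auto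
      then show ?case
        using insert
        by (simp add: V.lincomb_def V.finsum_insert image_subset_iff Pi_iff cls_smult cls_add)
    qed
  qed
  then show ?thesis by (simp add: lin_def)
qed

theorem alg_A_dim:
  "vectorspace.fin_dim class_ring (alg_A n i)" "vectorspace.dim class_ring (alg_A n i) = 6 * n + 3"
proof -
  interpret V: vectorspace class_ring "alg_A n i" by (rule alg_A_vectorspace)
  let ?B = "(\<lambda>k. cls (monomial k)) ` {..<3 * N}"
  have sub: "?B \<subseteq> carrier (alg_A n i)" by auto
  have "x \<in> V.span ?B" if x_in: "x \<in> carrier (alg_A n i)" for x
  proof -
    obtain F where x: "x = cls F" using x_in unfolding carrier_alg_A by blast
    obtain c where c: "F - lin c \<in> I" using exists_lin by blast
    define c' where "c' y = c (inv_into {..<3 * N} (\<lambda>k. cls (monomial k)) y)" for y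
    have "lin (\<lambda>k. c' (cls (monomial k))) = lin c"
      unfolding lin_def c'_def by (intro sum.cong) (auto simp: inv_into_f_f[OF inj_cls_monomial])
    then have "x = V.lincomb c' ?B"
      using c by (simp add: x lincomb_cls cls_eq_iff)
    then show ?thesis
      unfolding V.span_def by (auto intro!: exI[of _ c'] exI[of _ ?B])
  qed
  then have gen: "V.gen_set ?B"
    using V.span_is_subset2[OF sub] by blast
  have indep: "V.lin_indpt ?B"
  proof (rule V.finite_lin_indpt2)
    fix c assume "V.lincomb c ?B = \<zero>\<^bsub>alg_A n i\<^esub>"
    then have "lin (\<lambda>k. c (cls (monomial k))) \<in> I"
      by (simp add: lincomb_cls cls_zero cls_eq_iff)
    then show "\<forall>y\<in>?B. c y = \<zero>\<^bsub>class_ring\<^esub>"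
      by (auto simp: lin_in_I_iff)
  qed (use sub in auto)
  show "V.fin_dim"
    unfolding V.fin_dim_def using sub gen by blast
  have "V.dim = card ?B"
    by (rule V.dim_basis) (use gen indep sub in \<open>auto simp: V.basis_def\<close>)
  also have "\<dots> = 3 * N"
    by (simp add: card_image[OF inj_cls_monomial])
  finally show "V.dim = 6 * n + 3"
    by (simp add: N_def)
qed

section \<open>Lowest coefficients of powers\<close>

lemma f_lowest: "(f * p) $ N = p $ 0"
proof -
  have "(f * p) $ (N + 0) = f $ N * p $ 0"
    by (rule lowest_coeff_mult[OF X_power_dvd_f]) simp
  moreover have "N \<noteq> 2 * i" unfolding N_def by presburger
  then have "f $ N = 1" by (simp add: f_nth)
  ultimately show ?thesis by simp
qed

lemma X_dvd_f_mult: "fps_X ^ N dvd f * p"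
  using X_power_dvd_f by simp

lemma b_part_mult_nth: "k < 2 * N \<Longrightarrow> b_part (F * G) $ k = (b_part F * b_part G - f * (a_part F * flip (a_part G))) $ k"
  using X_power_dvd_nth[OF b_part_mult] by (simp add: mult.assoc)

lemma a_part_mult_nth: "k < N \<Longrightarrow> a_part (F * G) $ k = (b_part F * a_part G + a_part F * flip (b_part G)) $ k"
  using X_power_dvd_nth[OF a_part_mult] by simp

lemma b_part_one [simp]: "b_part 1 = 1" and a_part_one [simp]: "a_part 1 = 0"
  using b_part_ser[of 1] a_part_ser[of 1] by simp_all

lemma b_part_power_nth_0: "b_part (G ^ m) $ 0 = (b_part G $ 0) ^ m"
proof (induction m)
  case (Suc m)
  have "f $ 0 = 0" using N_ge_3 index by (auto simp: f_nth)
  then show ?case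
    using Suc b_part_mult_nth[of 0 G "G ^ m"] N_ge_3 by simp
qed simp

lemma nilpotent_imp_nth_0: "G ^ m \<in> I \<Longrightarrow> b_part G $ 0 = 0"
  using b_part_power_nth_0[of G m] X_power_dvd_nth[of "2 * N" "b_part (G ^ m)" 0] N_ge_3
  by (cases "m = 0") (auto simp: I_eq_K K_def)

lemma weight_ge_1: "b_part G $ 0 = 0 \<Longrightarrow> weight_ge 1 G"
  using N_ge_3 fps_X_power_dvd_iff[of 1 "b_part G"] by (simp add: weight_ge_def min_def)

lemma weight_ge_b_part: "weight_ge d F \<Longrightarrow> a \<le> d \<Longrightarrow> a \<le> 2 * N \<Longrightarrow> fps_X ^ a dvd b_part F"
  unfolding weight_ge_def by (elim conjE X_power_dvd_le) simp

lemma weight_ge_a_part: "weight_ge d F \<Longrightarrow> a < d \<Longrightarrow> a \<le> N \<Longrightarrow> fps_X ^ a dvd a_part F"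
  unfolding weight_ge_def by (elim conjE X_power_dvd_le) simp

lemma b_part_power_lowest:
  assumes "weight_ge 1 G" "m < 2 * N"
  shows "b_part (G ^ m) $ m = (b_part G $ 1) ^ m"
  using assms(2)
proof (induction m)
  case (Suc m)
  have w: "weight_ge m (G ^ m)" using weight_ge_power[OF assms(1), of m] by simp
  have "(b_part G * b_part (G ^ m)) $ (1 + m) = b_part G $ 1 * b_part (G ^ m) $ m"
    by (rule lowest_coeff_mult[OF weight_ge_b_part[OF assms(1)] weight_ge_b_part[OF w]])
      (use Suc N_ge_3 in auto)
  moreover have "(f * (a_part G * flip (a_part (G ^ m)))) $ (1 + m) = 0"
  proof (rule X_power_dvd_nth)
    have "fps_X ^ (min (m - 1) N) dvd a_part (G ^ m)"
      using w by (simp add: weight_ge_def)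
    then have "fps_X ^ (min (m - 1) N) dvd a_part G * flip (a_part (G ^ m))"
      by simp
    then show "fps_X ^ (m + 2) dvd f * (a_part G * flip (a_part (G ^ m)))"
      by (rule X_power_dvd_mult[OF X_power_dvd_f]) (use Suc N_ge_3 in auto)
  qed simp
  ultimately show ?case
    using b_part_mult_nth[of "1 + m" G "G ^ m"] Suc by simp
qed simp

text \<open>To lowest order \<open>G\<close> is \<open>r b + s a\<close>. As \<open>r b\<close> and \<open>s a\<close> anticommute and \<open>a\<^sup>2\<close> has order \<open>N > 2\<close>, the square is
\<open>r\<^sup>2 b\<^sup>2\<close> to lowest order, so even powers of \<open>G\<close> have no \<open>a\<close>-term of lowest weight, while for even \<open>m\<close> that
of \<open>G\<^sup>m\<^sup>+\<^sup>1\<close> is \<open>r\<^sup>m s b\<^sup>m a\<close>.\<close>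

lemma a_part_power_lowest:
  assumes "weight_ge 1 G" "m < N"
  shows "a_part (G ^ Suc m) $ m = (if even m then a_part G $ 0 * (b_part G $ 1) ^ m else 0)"
  using assms(2)
proof (induction m)
  case (Suc m)
  have w: "weight_ge (Suc m) (G ^ Suc m)" using weight_ge_power[OF assms(1), of "Suc m"] by simp
  have "(b_part G * a_part (G ^ Suc m)) $ (1 + m) = b_part G $ 1 * a_part (G ^ Suc m) $ m"
    by (rule lowest_coeff_mult[OF weight_ge_b_part[OF assms(1)] weight_ge_a_part[OF w]])
      (use Suc N_ge_3 in auto)
  moreover have fl: "fps_X ^ Suc m dvd flip (b_part (G ^ Suc m))"
    unfolding X_power_dvd_flip by (rule weight_ge_b_part[OF w]) (use Suc in auto)
  have "(a_part G * flip (b_part (G ^ Suc m))) $ (0 + Suc m) = a_part G $ 0 * flip (b_part (G ^ Suc m)) $ Suc m"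
    by (rule lowest_coeff_mult[OF _ fl]) simp
  moreover have "a_part (G * G ^ Suc m) $ Suc m = (b_part G * a_part (G ^ Suc m) + a_part G * flip (b_part (G ^ Suc m))) $ Suc m"
    using a_part_mult_nth[of "Suc m" G "G ^ Suc m"] Suc by simp
  moreover have "a_part (G ^ Suc m) $ m = (if even m then a_part G $ 0 * (b_part G $ 1) ^ m else 0)"
    using Suc by simp
  moreover have "b_part (G ^ Suc m) $ Suc m = (b_part G $ 1) ^ Suc m"
    by (rule b_part_power_lowest[OF assms(1)]) (use Suc in simp)
  ultimately have "a_part (G * G ^ Suc m) $ Suc m = (if even (Suc m) then a_part G $ 0 * (b_part G $ 1) ^ Suc m else 0)"
    by (cases "even m") (simp_all del: power_Suc of_nat_Suc add: power_Suc[of "b_part G $ 1"] power_Suc[of "- 1 :: complex"])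
  then show ?case by (simp only: power_Suc[of G "Suc m"])
qed simp

text \<open>Without a linear term in \<open>b\<close>, the square of \<open>G\<close> would have weight \<open>3\<close> instead of \<open>2\<close>, and \<open>G\<^sup>4\<^sup>n\<close>
would have weight \<open>6n \<ge> 4n + 2 = 2N\<close>.\<close>

lemma b_part_1_nonzero:
  assumes "weight_ge 1 G" "G ^ (4 * n) \<notin> I"
  shows "b_part G $ 1 \<noteq> 0"
proof
  assume 0: "b_part G $ 1 = 0"
  have "fps_X ^ 1 dvd b_part G" by (rule weight_ge_b_part[OF assms(1)]) (use N_ge_3 in auto)
  then have u2: "fps_X ^ 2 dvd b_part G"
    using 0 unfolding fps_X_power_dvd_iff by (auto simp: less_2_cases_iff)
  have u2': "fps_X ^ 2 dvd flip (b_part G)" using u2 by simp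
  have "fps_X ^ 3 dvd b_part G * b_part G - f * (a_part G * flip (a_part G))"
    by (intro dvd_diff X_power_dvd_mult[OF u2 u2] X_power_dvd_le[OF X_dvd_f_mult N_ge_3]) simp
  then have U: "fps_X ^ 3 dvd b_part (G ^ 2)"
    using N_ge_3 unfolding fps_X_power_dvd_iff by (simp add: power2_eq_square b_part_mult_nth)
  have "fps_X ^ 2 dvd b_part G * a_part G + a_part G * flip (b_part G)"
    using u2 u2' by simp
  then have V: "fps_X ^ 2 dvd a_part (G ^ 2)"
    using N_ge_3 unfolding fps_X_power_dvd_iff by (simp add: power2_eq_square a_part_mult_nth)
  have "weight_ge 3 (G ^ 2)"
    using U V N_ge_3 by (simp add: weight_ge_def min_def)
  then have "weight_ge (3 * (2 * n)) ((G ^ 2) ^ (2 * n))"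
    by (rule weight_ge_power)
  then have "(G ^ 2) ^ (2 * n) \<in> K"
    by (rule weight_ge_imp_K) (use n_pos in \<open>simp add: N_def\<close>)
  then have "G ^ (4 * n) \<in> I"
    by (simp add: I_eq_K flip: power_mult)
  then show False using assms(2) by simp
qed

lemma I_coeffs:
  assumes "F \<in> I"
  shows "k < 2 * N \<Longrightarrow> b_part F $ k = 0" "k < N \<Longrightarrow> a_part F $ k = 0"
  using assms X_power_dvd_nth unfolding I_eq_K K_def by blast+

section \<open>Images of the generators under an isomorphism\<close>

text \<open>The two coordinates of \<open>F G + G F = 0\<close>.\<close>

lemma anticommuting_relations:
  assumes "F * G + G * F \<in> I"
  shows "fps_X ^ (2 * N) dvd (b_part F * b_part G + b_part F * b_part G) - f * (a_part F * flip (a_part G) + a_part G * flip (a_part F))"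
    and "fps_X ^ N dvd a_part F * (b_part G + flip (b_part G)) + a_part G * (b_part F + flip (b_part F))"
proof -
  show "fps_X ^ (2 * N) dvd (b_part F * b_part G + b_part F * b_part G) - f * (a_part F * flip (a_part G) + a_part G * flip (a_part F))"
    unfolding fps_X_power_dvd_iff
  proof (intro allI impI)
    fix k assume k: "k < 2 * N"
    have "(b_part F * b_part G + b_part F * b_part G) - f * (a_part F * flip (a_part G) + a_part G * flip (a_part F))
        = (b_part F * b_part G - f * (a_part F * flip (a_part G))) + (b_part G * b_part F - f * (a_part G * flip (a_part F)))"
      by (simp add: algebra_simps)
    also have "\<dots> $ k = b_part (F * G + G * F) $ k"
      by (simp only: b_part_linear fps_add_nth b_part_mult_nth[OF k])
    finally show "((b_part F * b_part G + b_part F * b_part G) - f * (a_part F * flip (a_part G) + a_part G * flip (a_part F))) $ k = 0"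
      using I_coeffs(1)[OF assms k] by simp
  qed
  show "fps_X ^ N dvd a_part F * (b_part G + flip (b_part G)) + a_part G * (b_part F + flip (b_part F))"
    unfolding fps_X_power_dvd_iff
  proof (intro allI impI)
    fix k assume k: "k < N"
    have "a_part F * (b_part G + flip (b_part G)) + a_part G * (b_part F + flip (b_part F))
        = (b_part F * a_part G + a_part F * flip (b_part G)) + (b_part G * a_part F + a_part G * flip (b_part F))"
      by (simp add: algebra_simps)
    also have "\<dots> $ k = a_part (F * G + G * F) $ k"
      using k by (simp add: a_part_mult_nth)
    finally show "(a_part F * (b_part G + flip (b_part G)) + a_part G * (b_part F + flip (b_part F))) $ k = 0"
      using I_coeffs(2)[OF assms k] by simp
  qed
qed

text \<open>Four numbers govern the lowest terms: \<open>q\<close> and \<open>c\<close> are the coefficients of \<open>a\<close> and \<open>b\<^sup>2\<^sup>n\<close> in \<open>F\<close>, and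
\<open>r\<close>, \<open>s\<close> those of \<open>b\<close>, \<open>a\<close> in \<open>G\<close>. The coefficient of \<open>b\<^sup>N\<close> in \<open>F G + G F = 0\<close> gives \<open>c r = q s\<close>, the
coefficients of \<open>b\<^sup>N\<close> and \<open>b\<^sup>2\<^sup>n a\<close> in the second relation give \<open>q\<^sup>2 = r\<^sup>N\<close> and
\<open>2 q c + r\<^sup>2\<^sup>n s = 0\<close>. Multiplying the last equation by \<open>r\<close> and inserting the others yields \<open>3 q\<^sup>2 s = 0\<close>. Hence \<open>s = c = 0\<close>, so \<open>b_part F\<close> has order at least \<open>N\<close>, and
the second coordinate of \<open>F G + G F = 0\<close> bounds the even part of \<open>b_part G\<close>.\<close>

lemma rigidity:
  fixes l :: nat
  defines "e \<equiv> \<lambda>G :: (letter, complex) ncfps. if l = 0 then 0 else G ^ (2 * l)"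
  assumes l: "l = 0 \<or> n < l"
    and w: "weight_ge 1 G" and r0: "b_part G $ 1 \<noteq> 0"
    and anti: "F * G + G * F \<in> I" and sq: "F ^ 2 + (G ^ N + e G) \<in> I"
  shows "a_part F $ 0 \<noteq> 0" "fps_X ^ N dvd b_part F" "fps_X ^ N dvd b_part G + flip (b_part G)" "a_part G $ 0 = 0"
proof -
  define q r s c where "q = a_part F $ 0" and "r = b_part G $ 1" and "s = a_part G $ 0" and "c = b_part F $ (2 * n)"
  have r: "r \<noteq> 0" using r0 by (simp add: r_def)
  note rel = anticommuting_relations[OF anti]
  have uG: "fps_X ^ 1 dvd b_part G"
    by (rule weight_ge_b_part[OF w]) (use N_ge_3 in auto)
  have N1: "N = 2 * n + 1" by (simp add: N_def)
  have "fps_X ^ N dvd (b_part F * b_part G + b_part F * b_part G)"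
  proof -
    have "fps_X ^ N dvd (b_part F * b_part G + b_part F * b_part G) - f * (a_part F * flip (a_part G) + a_part G * flip (a_part F))"
      by (rule X_power_dvd_le[OF rel(1)]) simp
    from dvd_add[OF this X_dvd_f_mult] show ?thesis by (metis diff_add_cancel)
  qed
  then have "fps_X ^ (2 * n + 1) dvd b_part F * b_part G"
    unfolding fps_X_power_dvd_iff N1[symmetric] fps_add_nth
    by simp
  then have uF: "fps_X ^ (2 * n) dvd b_part F"
    by (rule X_power_dvd_cancel[OF _ uG r0])
  have "0 = ((b_part F * b_part G + b_part F * b_part G) - f * (a_part F * flip (a_part G) + a_part G * flip (a_part F))) $ N"
    using X_power_dvd_nth[OF rel(1), of N] N_ge_3 by simp
  also have "\<dots> = (b_part F * b_part G) $ (2 * n + 1) + (b_part F * b_part G) $ (2 * n + 1) - 2 * (q * s)"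
    unfolding fps_sub_nth f_lowest N1[symmetric] fps_add_nth by (simp add: q_def s_def)
  also have "(b_part F * b_part G) $ (2 * n + 1) = c * r"
    unfolding c_def r_def by (rule lowest_coeff_mult[OF uF uG])
  finally have cr: "c * r = q * s" by simp

  \<comment> \<open>The term with index \<open>l\<close> has order \<open>2l > N\<close> and is invisible in all coefficients used here.\<close>
  have we: "weight_ge (N + 1) (e G)"
  proof (cases "l = 0")
    case False
    then have "2 * l = N + 1 + (2 * l - (N + 1))" using l by (simp add: N1)
    then have "e G = G ^ (N + 1) * G ^ (2 * l - (N + 1))"
      using False unfolding e_def by (metis power_add)
    then show ?thesis
      using weight_ge_mult[OF weight_ge_power[OF w, of "N + 1"] weight_ge_0[of "G ^ (2 * l - (N + 1))"]] by simp
  qed (simp add: e_def weight_ge_def)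
  have "0 = b_part (F ^ 2 + (G ^ N + e G)) $ N"
    using I_coeffs(1)[OF sq, of N] N_ge_3 by simp
  also have "\<dots> = (b_part F * b_part F - f * (a_part F * flip (a_part F))) $ N + b_part (G ^ N) $ N + b_part (e G) $ N"
    using N_ge_3 by (simp add: power2_eq_square b_part_mult_nth)
  \<comment> \<open>The order of this square is at least \<open>4n > 2n + 1\<close>.\<close>
  also have "(b_part F * b_part F) $ N = 0"
    by (rule X_power_dvd_nth[OF X_power_dvd_mult[OF uF uF order_refl]]) (use n_pos in \<open>simp add: N1\<close>)
  then have "(b_part F * b_part F - f * (a_part F * flip (a_part F))) $ N = - (q * q)"
    by (simp add: f_lowest q_def)
  also have "b_part (G ^ N) $ N = r ^ N"
    unfolding r_def by (rule b_part_power_lowest[OF w]) (use N_ge_3 in simp)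
  also have "b_part (e G) $ N = 0"
    by (rule X_power_dvd_nth[OF weight_ge_b_part[OF we order_refl]]) (use N_ge_3 in auto)
  finally have qq: "q * q = r ^ N" by simp
  then have q: "q \<noteq> 0" using r by auto
  then show "a_part F $ 0 \<noteq> 0" by (simp add: q_def)

  have even_uF: "fps_X ^ (2 * n) dvd b_part F + flip (b_part F)" using uF by simp
  have "0 = a_part (F ^ 2 + (G ^ N + e G)) $ (2 * n)"
    using I_coeffs(2)[OF sq, of "2 * n"] by (simp add: N1)
  also have "\<dots> = (a_part F * (b_part F + flip (b_part F))) $ (0 + 2 * n) + a_part (G ^ N) $ (2 * n) + a_part (e G) $ (2 * n)"
    by (simp add: N1 power2_eq_square a_part_mult_nth distrib_left mult.commute)
  also have "(a_part F * (b_part F + flip (b_part F))) $ (0 + 2 * n) = q * (2 * c)"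
    by (subst lowest_coeff_mult[OF _ even_uF]) (simp_all add: q_def c_def)
  also have "a_part (G ^ N) $ (2 * n) = s * r ^ (2 * n)"
    using a_part_power_lowest[OF w, of "2 * n"] by (simp add: N1 r_def s_def)
  also have "a_part (e G) $ (2 * n) = 0"
    by (rule X_power_dvd_nth[OF weight_ge_a_part[OF we, of N]]) (simp_all add: N1)
  finally have "(q * (2 * c) + s * r ^ (2 * n)) * r = 0" by simp
  then have "2 * q * (c * r) + s * r ^ N = 0"
    by (simp add: N1 algebra_simps)
  then have "3 * (q * q) * s = 0"
    by (simp add: cr flip: qq)
  then have s: "s = 0" using q by simp
  then have c: "c = 0" using cr r by simp
  show "a_part G $ 0 = 0" using s by (simp add: s_def)
  show uFN: "fps_X ^ N dvd b_part F"
    using uF c unfolding fps_X_power_dvd_iff N1 by (auto simp: c_def less_Suc_eq)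
  have "fps_X ^ N dvd a_part G * (b_part F + flip (b_part F))" using uFN by simp
  from dvd_diff[OF rel(2) this] have "fps_X ^ (N + 0) dvd (b_part G + flip (b_part G)) * a_part F"
    by (simp add: mult.commute)
  then show "fps_X ^ N dvd b_part G + flip (b_part G)"
    by (rule X_power_dvd_cancel) (use q q_def in auto)
qed

text \<open>If the even part of \<open>b_part G\<close> has order at least \<open>N\<close>, the \<open>a\<close>-coordinate of \<open>G\<^sup>2\<close> vanishes, so powers of \<open>G\<^sup>2\<close> are
computed in the commutative ring of power series in \<open>b\<close>.\<close>

lemma square_power:
  assumes "fps_X ^ N dvd b_part G + flip (b_part G)"
  shows "fps_X ^ N dvd a_part (G ^ (2 * m))"
    and "fps_X ^ (2 * N) dvd b_part (G ^ (2 * m)) - b_part (G ^ 2) ^ m"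
proof -
  have "fps_X ^ N dvd a_part G * (b_part G + flip (b_part G))" using assms by simp
  then have v2: "fps_X ^ N dvd a_part (G ^ 2)"
    unfolding fps_X_power_dvd_iff
    by (auto simp: power2_eq_square a_part_mult_nth distrib_left mult.commute)
  have "fps_X ^ N dvd a_part (G ^ (2 * m)) \<and> fps_X ^ (2 * N) dvd b_part (G ^ (2 * m)) - b_part (G ^ 2) ^ m"
  proof (induction m)
    case (Suc m)
    define H where "H = G ^ (2 * m)"
    have H: "G ^ (2 * Suc m) = G ^ 2 * H"
      by (simp add: H_def power2_eq_square mult.assoc)
    have IH: "fps_X ^ N dvd a_part H" "fps_X ^ (2 * N) dvd b_part H - b_part (G ^ 2) ^ m"
      using Suc by (simp_all add: H_def)
    have "fps_X ^ N dvd b_part (G ^ 2) * a_part H + a_part (G ^ 2) * flip (b_part H)"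
      using IH(1) v2 by simp
    from dvd_add[OF a_part_mult[of "G ^ 2" H] this] have V: "fps_X ^ N dvd a_part (G ^ 2 * H)" by simp
    have "fps_X ^ N dvd a_part (G ^ 2) * flip (a_part H)" using v2 by simp
    then have 1: "fps_X ^ (2 * N) dvd f * (a_part (G ^ 2) * flip (a_part H))"
      by (rule X_power_dvd_mult[OF X_power_dvd_f]) simp
    have 2: "fps_X ^ (2 * N) dvd b_part (G ^ 2) * (b_part H - b_part (G ^ 2) ^ m)"
      using IH(2) by simp
    have "b_part (G ^ 2 * H) - b_part (G ^ 2) ^ Suc m
        = (b_part (G ^ 2 * H) - (b_part (G ^ 2) * b_part H - f * a_part (G ^ 2) * flip (a_part H)))
          + (b_part (G ^ 2) * (b_part H - b_part (G ^ 2) ^ m) - f * (a_part (G ^ 2) * flip (a_part H)))"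
      by (simp add: algebra_simps)
    then have "fps_X ^ (2 * N) dvd b_part (G ^ 2 * H) - b_part (G ^ 2) ^ Suc m"
      using dvd_add[OF b_part_mult[of "G ^ 2" H] dvd_diff[OF 2 1]] by (simp only:)
    with V show ?case unfolding H by simp
  qed simp
  then show "fps_X ^ N dvd a_part (G ^ (2 * m))"
    and "fps_X ^ (2 * N) dvd b_part (G ^ (2 * m)) - b_part (G ^ 2) ^ m" by blast+
qed

text \<open>Writing \<open>\<beta>\<close>, \<open>\<gamma>\<close> for the coordinates of \<open>G\<close>, the first coordinate of \<open>G\<^sup>2\<close> is \<open>\<beta>\<^sup>2 - f \<gamma> flip(\<gamma>)\<close>. The odd part of
\<open>\<beta>\<^sup>2\<close> is the product of the odd and the even part of \<open>\<beta>\<close>, up to a factor, and \<open>f \<gamma> flip(\<gamma>)\<close> has order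
greater than \<open>N\<close>.\<close>

lemma square_nearly_even:
  assumes w: "weight_ge 1 G" and even: "fps_X ^ N dvd b_part G + flip (b_part G)" and v0: "a_part G $ 0 = 0"
  defines "P \<equiv> b_part (G ^ 2)"
  shows "fps_X ^ (N + 1) dvd P - flip P" "fps_X ^ 2 dvd P"
proof -
  have w2: "weight_ge 2 (G ^ 2)" using weight_ge_power[OF w, of 2] by simp
  show "fps_X ^ 2 dvd P"
    unfolding P_def by (rule weight_ge_b_part[OF w2]) (use N_ge_3 in auto)
  have uG: "fps_X ^ 1 dvd b_part G" by (rule weight_ge_b_part[OF w]) (use N_ge_3 in auto)
  have uG': "fps_X ^ 1 dvd b_part G - flip (b_part G)"
    using uG by (intro dvd_diff) (simp_all only: X_power_dvd_flip)
  have "fps_X ^ (N + 1) dvd (b_part G + flip (b_part G)) * (b_part G - flip (b_part G))"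
    by (rule X_power_dvd_mult[OF even uG']) simp
  moreover have vG: "fps_X ^ 1 dvd a_part G * flip (a_part G)"
    using v0 fps_X_power_dvd_iff[of 1 "a_part G"] by simp
  have "fps_X ^ N dvd f - flip f"
    using X_power_dvd_f by (intro dvd_diff) (simp_all only: X_power_dvd_flip)
  then have "fps_X ^ (N + 1) dvd (f - flip f) * (a_part G * flip (a_part G))"
    by (rule X_power_dvd_mult[OF _ vG]) simp
  ultimately have "fps_X ^ (N + 1) dvd (b_part G + flip (b_part G)) * (b_part G - flip (b_part G))
      - (f - flip f) * (a_part G * flip (a_part G))"
    by (rule dvd_diff)
  moreover define R where "R = P - (b_part G * b_part G - f * a_part G * flip (a_part G))"
  have R: "fps_X ^ (N + 1) dvd R"
    unfolding R_def P_def power2_eq_square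
    by (rule X_power_dvd_le[OF b_part_mult]) (use N_ge_3 in simp)
  then have "fps_X ^ (N + 1) dvd R - flip R"
    by (intro dvd_diff) (simp_all only: X_power_dvd_flip)
  moreover have "P - flip P = ((b_part G + flip (b_part G)) * (b_part G - flip (b_part G))
      - (f - flip f) * (a_part G * flip (a_part G))) + (R - flip R)"
    by (simp add: R_def algebra_simps)
  ultimately show "fps_X ^ (N + 1) dvd P - flip P"
    by (simp only: dvd_add)
qed

text \<open>Here \<open>F\<close> and \<open>G\<close> stand for the images of \<open>a\<close> and \<open>b\<close> under an isomorphism from the algebra with index \<open>l\<close>. Adding the
first coordinate of \<open>F\<^sup>2 + G\<^sup>N + G\<^sup>2\<^sup>l = 0\<close> to its flip isolates the even part, in which \<open>G\<^sup>N\<close>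
does not contribute.\<close>

lemma index_determined:
  fixes l :: nat
  defines "e \<equiv> \<lambda>G :: (letter, complex) ncfps. if l = 0 then 0 else G ^ (2 * l)"
  assumes l: "l = 0 \<or> n < l" "l \<le> 2 * n" and i: "i \<le> 2 * n"
    and nil: "G ^ (2 * N) \<in> I" and non_nil: "G ^ (4 * n) \<notin> I"
    and anti: "F * G + G * F \<in> I" and sq: "F ^ 2 + (G ^ N + e G) \<in> I"
  shows "l = i"
proof -
  have w: "weight_ge 1 G"
    by (rule weight_ge_1[OF nilpotent_imp_nth_0[OF nil]])
  have r: "b_part G $ 1 \<noteq> 0" by (rule b_part_1_nonzero[OF w non_nil])
  note rig = rigidity[OF l(1) w r anti sq[unfolded e_def]]
  have uG: "fps_X ^ 1 dvd b_part G" by (rule weight_ge_b_part[OF w]) (use N_ge_3 in auto)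
  have N1: "N = 2 * n + 1" by (simp add: N_def)
  define P where "P = b_part (G ^ 2)"
  note P = square_nearly_even[OF w rig(3,4), folded P_def]
  have P': "fps_X ^ 2 dvd flip P" using P(2) by simp
  note sp = square_power[OF rig(3), folded P_def]
  define E where "E = a_part F * flip (a_part F)"
  have sym: "flip E = E" by (simp add: E_def mult.commute)

  have T: "fps_X ^ (2 * N) dvd P ^ n * b_part G + b_part (e G) - f * E"
  proof -
    have uF2: "fps_X ^ (2 * N) dvd b_part F * b_part F"
      by (rule X_power_dvd_mult[OF rig(2) rig(2)]) simp
    have F2: "fps_X ^ (2 * N) dvd b_part (F ^ 2) - (b_part F * b_part F - f * E)"
      using b_part_mult[of F F] by (simp add: power2_eq_square E_def mult.assoc)
    have GN: "fps_X ^ (2 * N) dvd b_part (G ^ N) - P ^ n * b_part G"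
    proof -
      have G: "G ^ N = G ^ (2 * n) * G" by (simp add: N1 power_commutes)
      have "fps_X ^ N dvd a_part (G ^ (2 * n)) * flip (a_part G)" using sp(1) by simp
      then have 1: "fps_X ^ (2 * N) dvd f * (a_part (G ^ (2 * n)) * flip (a_part G))"
        by (rule X_power_dvd_mult[OF X_power_dvd_f]) simp
      have 2: "fps_X ^ (2 * N) dvd (b_part (G ^ (2 * n)) - P ^ n) * b_part G"
        using sp(2) by simp
      show ?thesis
        using dvd_add[OF b_part_mult[of "G ^ (2 * n)" G] dvd_diff[OF 2 1]]
        unfolding G by (simp add: algebra_simps)
    qed
    have "fps_X ^ (2 * N) dvd b_part (F ^ 2) + (b_part (G ^ N) + b_part (e G))"
      using sq by (simp add: I_eq_K K_def)
    from dvd_diff[OF dvd_diff[OF dvd_diff[OF this uF2] F2] GN]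
    have "fps_X ^ (2 * N) dvd (b_part (F ^ 2) + (b_part (G ^ N) + b_part (e G))) - b_part F * b_part F
       - (b_part (F ^ 2) - (b_part F * b_part F - f * E)) - (b_part (G ^ N) - P ^ n * b_part G)" .
    then show ?thesis by (simp add: algebra_simps)
  qed
  \<comment> \<open>Working modulo \<open>X\<^sup>4\<^sup>n\<^sup>+\<^sup>1\<close> suffices: the exponents \<open>2l\<close> and \<open>2i\<close> are at most \<open>4n\<close>.\<close>
  have Pn: "fps_X ^ (4 * n + 1) dvd P ^ n * b_part G + flip (P ^ n * b_part G)"
  proof -
    \<comment> \<open>With \<open>\<beta> = b_part G\<close>, split the sum as \<open>P\<^sup>n (\<beta> + flip \<beta>) - (P\<^sup>n - flip P\<^sup>n) flip \<beta>\<close>.\<close>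
    obtain m where m: "n = Suc m" using n_pos by (cases n) auto
    have "fps_X ^ (2 * n) dvd P ^ n"
      using dvd_power_same[OF P(2), of n] by (simp only: power_mult)
    then have 1: "fps_X ^ (4 * n + 1) dvd P ^ n * (b_part G + flip (b_part G))"
      by (rule X_power_dvd_mult[OF _ rig(3)]) (simp add: N1)
    have fG: "fps_X ^ 1 dvd flip (b_part G)" using uG by (simp only: X_power_dvd_flip)
    have "fps_X ^ (N + 1 + 2 * m) dvd P ^ n - flip P ^ n"
      by (rule X_power_dvd_power_diff[OF P P', of m, folded m])
    then have "fps_X ^ (4 * n + 1) dvd (P ^ n - flip P ^ n) * flip (b_part G)"
      by (rule X_power_dvd_mult[OF _ fG]) (use m N1 in linarith)
    from dvd_diff[OF 1 this] show ?thesis by (simp add: algebra_simps)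
  qed
  have e: "fps_X ^ (4 * n + 1) dvd b_part (e G) - flip (b_part (e G))"
  proof (cases "l = 0")
    case False
    then obtain m where m: "l = Suc m" by (cases l) auto
    have 1: "fps_X ^ (4 * n + 1) dvd P ^ l - flip P ^ l"
      by (rule X_power_dvd_le[OF X_power_dvd_power_diff[OF P P', of m, folded m]])
        (use l False in \<open>simp add: N1 m\<close>)
    have 2: "fps_X ^ (4 * n + 1) dvd b_part (e G) - P ^ l"
      by (rule X_power_dvd_le[of "2 * N"]) (use sp(2)[of l] False in \<open>simp_all add: e_def N1 del: power_Suc\<close>)
    then have 3: "fps_X ^ (4 * n + 1) dvd flip (b_part (e G) - P ^ l)"
      by (simp only: X_power_dvd_flip)
    show ?thesis
      using dvd_add[OF dvd_diff[OF 2 3] 1] by simp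
  qed (simp add: e_def)
  have main: "fps_X ^ (4 * n + 1) dvd (b_part (e G) + b_part (e G)) - (f + flip f) * E"
  proof -
    define T where "T = P ^ n * b_part G + b_part (e G) - f * E"
    have T1: "fps_X ^ (4 * n + 1) dvd T"
      unfolding T_def by (rule X_power_dvd_le[OF T]) (simp add: N1)
    then have T2: "fps_X ^ (4 * n + 1) dvd flip T" by (simp only: X_power_dvd_flip)
    have "(b_part (e G) + b_part (e G)) - (f + flip f) * E
        = T + flip T - (P ^ n * b_part G + flip (P ^ n * b_part G)) + (b_part (e G) - flip (b_part (e G)))"
      by (simp add: T_def sym algebra_simps)
    then show ?thesis
      using dvd_add[OF dvd_diff[OF dvd_add[OF T1 T2] Pn] e] by (simp only:)
  qed
  have ff: "(f + flip f) = (if i = 0 then 0 else fps_X ^ (2 * i) + fps_X ^ (2 * i))"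
    by (auto simp: f_def N1 power_minus_odd)
  have coeff: "b_part (e G) $ k = (if i = 0 then 0 else (fps_X ^ (2 * i) * E) $ k)" if "k \<le> 4 * n" for k
  proof -
    have "((b_part (e G) + b_part (e G)) - (f + flip f) * E) $ k = 0"
      by (rule X_power_dvd_nth[OF main]) (use that in simp)
    then have *: "b_part (e G) $ k + b_part (e G) $ k = ((f + flip f) * E) $ k"
      by (simp only: fps_sub_nth fps_add_nth right_minus_eq)
    show ?thesis
    proof (cases "i = 0")
      case True
      then show ?thesis using * unfolding ff by simp
    next
      case False
      then have "((f + flip f) * E) $ k = (fps_X ^ (2 * i) * E) $ k + (fps_X ^ (2 * i) * E) $ k"
        unfolding ff by (simp only: if_False distrib_right fps_add_nth)
      then show ?thesis using * False by simp
    qed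
  qed
  have E0: "E $ 0 \<noteq> 0" using rig(1) by (simp add: E_def)
  show "l = i"
  proof (rule ccontr)
    assume "l \<noteq> i"
    then consider "l \<noteq> 0" "i = 0 \<or> l < i" | "i \<noteq> 0" "l = 0 \<or> i < l" by linarith
    then show False
    proof cases
      case 1
      have "b_part (e G) $ (2 * l) = (b_part G $ 1) ^ (2 * l)"
        using b_part_power_lowest[OF w, of "2 * l"] l 1(1) by (simp add: e_def N1)
      moreover have "(if i = 0 then 0 else (fps_X ^ (2 * i) * E) $ (2 * l)) = 0"
        using 1(2) by (auto simp: fps_X_power_mult_nth)
      ultimately show False using coeff[of "2 * l"] l(2) r by simp
    next
      case 2
      have "b_part (e G) $ (2 * i) = 0"
      proof (cases "l = 0")
        case False
        have "weight_ge (2 * l) (G ^ (2 * l))" using weight_ge_power[OF w, of "2 * l"] by simp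
        from weight_ge_b_part[OF this, of "2 * l"] have "fps_X ^ (2 * l) dvd b_part (e G)"
          using l(2) False by (simp add: e_def N1)
        then show ?thesis by (rule X_power_dvd_nth) (use 2 False in simp)
      qed (simp add: e_def)
      moreover have "(fps_X ^ (2 * i) * E) $ (2 * i) = E $ 0"
        by (simp add: fps_X_power_mult_nth)
      ultimately show False using coeff[of "2 * i"] i 2(1) E0 by simp
    qed
  qed
qed

lemma b_power_notin_I: "k < 2 * N \<Longrightarrow> ser_b ^ k \<notin> I"
  using I_coeffs(1)[of "ser_b ^ k" k] by (auto simp flip: ser_X_power)

end

section \<open>The algebras are pairwise non-isomorphic\<close>

theorem isomorphic_imp_index_eq:
  assumes "A_algebra n i" "A_algebra n j" "i \<le> 2 * n" "j \<le> 2 * n"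
    and iso: "algebra_isomorphic (alg_A n i) (alg_A n j)"
  shows "i = j"
proof -
  interpret A: A_algebra n i by fact
  interpret B: A_algebra n j by fact
  obtain h where h: "h \<in> ring_iso (alg_A n i) (alg_A n j)"
    using iso by (auto simp: algebra_isomorphic_def algebra_iso_def)
  have hom: "h \<in> Ring.ring_hom (alg_A n i) (alg_A n j)" and bij: "bij_betw h (carrier (alg_A n i)) (carrier (alg_A n j))"
    using h by (auto simp: ring_iso_def)
  \<comment> \<open>\<open>lift x y\<close>: the series \<open>y\<close> represents the image of the class of \<open>x\<close>.\<close>
  define lift where "lift x y \<longleftrightarrow> h (A.cls x) = B.cls y" for x y
  have lift_mult: "lift (x * x') (y * y')" and lift_add: "lift (x + x') (y + y')"
    if "lift x y" "lift x' y'" for x y x' y'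
    using that ring_hom_mult[OF hom, of "A.cls x" "A.cls x'"] ring_hom_add[OF hom, of "A.cls x" "A.cls x'"]
    by (simp_all add: lift_def A.cls_mult B.cls_mult A.cls_add B.cls_add)
  have lift_power: "lift (x ^ Suc m) (y ^ Suc m)" if "lift x y" for x y m
    using that by (induction m) (simp_all add: lift_mult)
  have "ring (alg_A n i)" "ring (alg_A n j)"
    unfolding A.alg_A_eq B.alg_A_eq by (rule nc_quotient_ring)+
  then have h0: "h (A.cls 0) = B.cls 0"
    using ring_hom_zero[OF hom] by (simp add: A.cls_zero B.cls_zero)
  have lift_0: "x \<in> A.I \<longleftrightarrow> y \<in> B.I" if "lift x y" for x y
  proof -
    have "x \<in> A.I \<longleftrightarrow> A.cls x = A.cls 0" by (simp add: A.cls_eq_iff)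
    also have "\<dots> \<longleftrightarrow> h (A.cls x) = h (A.cls 0)"
      using inj_on_eq_iff[OF bij_betw_imp_inj_on[OF bij]] by simp
    also have "\<dots> \<longleftrightarrow> y \<in> B.I"
      using that by (simp add: lift_def h0 B.cls_eq_iff)
    finally show ?thesis .
  qed
  have ex: "\<exists>y. lift x y" for x
    using bij_betwE[OF bij, rule_format, OF A.cls_in_carrier[of x]]
    unfolding lift_def B.carrier_alg_A by auto
  obtain F G where F: "lift ser_a F" and G: "lift ser_b G" using ex by meson
  have pow: "lift (ser_b ^ m) (G ^ m)" if "m > 0" for m
    using lift_power[OF G, of "m - 1"] that by simp
  define e where "e = (\<lambda>G :: (letter, complex) ncfps. if i = 0 then 0 else G ^ (2 * i))"
  have le: "lift (e ser_b) (e G)"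
    using pow[of "2 * i"] h0 by (auto simp: e_def lift_def)
  have N0: "B.N > 0" using B.N_ge_3 by simp
  show "i = j"
  proof (rule B.index_determined)
    show "F * G + G * F \<in> B.I"
      using lift_0[OF lift_add[OF lift_mult[OF F G] lift_mult[OF G F]]] A.rel_commute by simp
    have "lift (ser_a ^ 2 + (ser_b ^ B.N + e ser_b)) (F ^ 2 + (G ^ B.N + e G))"
      using lift_add[OF lift_mult[OF F F] lift_add[OF pow[OF N0] le]] by (simp add: power2_eq_square)
    from lift_0[OF this] have "F ^ 2 + (G ^ B.N + e G) \<in> B.I"
      using A.rel_square by (simp add: A.f_ser e_def)
    then show "F ^ 2 + (G ^ B.N + (if i = 0 then 0 else G ^ (2 * i))) \<in> B.I"
      by (simp add: e_def)
    show "G ^ (2 * B.N) \<in> B.I"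
      using lift_0[OF pow[of "2 * B.N"]] A.b_power_0 N0 by simp
    show "G ^ (4 * n) \<notin> B.I"
      using lift_0[OF pow[of "4 * n"]] A.b_power_notin_I[of "4 * n"] A.n_pos by (simp add: A.N_def)
  qed (use assms A.index in auto)
qed

theorem theorem5p10:
  fixes n :: nat
  assumes "n \<ge> 1"
  shows "(\<forall>i \<in> {0} \<union> {n + 1..2 * n}.
            vectorspace.fin_dim class_ring (alg_A n i) \<and>
            vectorspace.dim class_ring (alg_A n i) = 6 * n + 3) \<and>
         (\<forall>i \<in> {0} \<union> {n + 1..2 * n}. \<forall>j \<in> {0} \<union> {n + 1..2 * n}.
            i \<noteq> j \<longrightarrow> \<not> algebra_isomorphic (alg_A n i) (alg_A n j))"
proof -
  have A: "A_algebra n i" "i \<le> 2 * n" if "i \<in> {0} \<union> {n + 1..2 * n}" for i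
    using that assms by (auto simp: A_algebra_def)
  show ?thesis
    using A_algebra.alg_A_dim[OF A(1)] isomorphic_imp_index_eq[OF A(1) A(1) A(2) A(2)] by blast
qed

end
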